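(* $\mathsf{UC}_{\mathbb{N}^\mathbb{N}}<_{\mathrm W}\widehat{\Sigma^1_1\text{-}\mathsf{C}_{\mathbf 2}}\equiv_{\mathrm W}\Pi^1_1\text{-}\mathsf{Sep}\equiv_{\mathrm W}\Sigma^1_1\text{-}\mathsf{WKL}<_{\mathrm W}\widehat{\Sigma^1_1\text{-}\mathsf{C}_{\mathbb{N}}}\le_{\mathrm W}\mathsf{C}_{\mathbb{N}^\mathbb{N}}$.
   Context: A represented space is a set $X$ with a partial surjection $\delta_X:\subseteq\mathbb{N}^\mathbb{N}\to X$ (names). A partial $F:\subseteq\mathbb{N}^\mathbb{N}\to\mathbb{N}^\mathbb{N}$ realizes a partial multivalued $f:\subseteq X\rightrightarrows Y$ if for every $x\in\operatorname{dom}(f)$ and name $p$ of $x$, $F(p)$ names an element of $f(x)$. $f\le_{\mathrm W}g$ if there are computable partial $H,K:\subseteq\mathbb{N}^\mathbb{N}\to\mathbb{N}^\mathbb{N}$ such that for every realizer $G$ of $g$, $p\mapsto K(\langle p,G(H(p))\rangle)$ realizes $f$; $\equiv_{\mathrm W}$ is mutual reducibility and $f<_{\mathrm W}g$ means $f\le_{\mathrm W}g$ and $g\not\le_{\mathrm W}f$. The parallelization $\widehat f$ takes a sequence $(x_i)_i$ of inputs of $f$ and outputs a sequence $(y_i)_i$ with $y_i\in f(x_i)$ for all $i$. Closed subsets of $\mathbb{N}^\mathbb{N}$ are named by trees $T\subseteq\mathbb{N}^{<\mathbb{N}}$ (characteristic functions) with $[T]$ (the set of infinite paths) equal to the set. $\mathsf{C}_{\mathbb{N}^\mathbb{N}}$: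 given a nonempty closed $A\subseteq\mathbb{N}^\mathbb{N}$, output some element of $A$; $\mathsf{UC}_{\mathbb{N}^\mathbb{N}}$ is its restriction to singletons. For a countable set $D$ identified with $\mathbb{N}$ via a computable bijection (e.g. $D=\mathbb{N}$, $D=\{0,1\}$, $D=2^{<\omega}$), a $\Sigma^1_1$-name of $S\subseteq D$ is a sequence of trees $(T_d)_{d\in D}$ with $d\in S$ iff $[T_d]\neq\emptyset$; a $\Pi^1_1$-name of $S$ is a sequence of trees with $d\in S$ iff $[T_d]=\emptyset$. $\Sigma^1_1\text{-}\mathsf{C}_{\mathbf 2}$ (resp. $\Sigma^1_1\text{-}\mathsf{C}_{\mathbb{N}}$): given a $\Sigma^1_1$-name of a nonempty subset of $\{0,1\}$ (resp. $\mathbb{N}$), output an element of it. $\Pi^1_1\text{-}\mathsf{Sep}$: given $\Pi^1_1$-names of disjoint $A,B\subseteq\mathbb{N}$, output (the characteristic function of) some $C\subseteq\mathbb{N}$ with $A\subseteq C$ and $B\cap C=\emptyset$. $\Sigma^1_1\text{-}\mathsf{WKL}$: given a $\Sigma^1_1$-name of a set $T\subseteq 2^{<\omega}$ which is an infinite binary tree, output an infinite path through $T$. *)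

theory Defs
  imports "HOL-Analysis.Function_Topology" "HOL-Library.Nat_Bijection" "HOL-Library.Sublist"
begin

section \<open>Computable partial functions on Baire space\<close>

type_synonym baire = "nat \<Rightarrow> nat"

text \<open>
  Programs for the functions that are partial recursive relative to some \<open>p :: baire\<close>. All functions
  are unary; several arguments are passed through the bijection \<^const>\<open>prod_encode\<close>.
\<close>

datatype prog =
    Zero | Succ | Fst | Snd | Query
  | Tup prog prog | Comp prog prog | Prec prog prog | Mu prog

text \<open>\<open>evals p c x y\<close>: program \<open>c\<close> with access to \<open>p\<close> halts on input \<open>x\<close> with output \<open>y\<close>.\<close>

inductive evals :: "baire \<Rightarrow> prog \<Rightarrow> nat \<Rightarrow> nat \<Rightarrow> bool" for p :: baire where
  evals_Zero: "evals p Zero x 0"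
| evals_Succ: "evals p Succ x (Suc x)"
| evals_Fst: "evals p Fst (prod_encode (x, y)) x"
| evals_Snd: "evals p Snd (prod_encode (x, y)) y"
| evals_Query: "evals p Query x (p x)"
| evals_Tup: "evals p c x y \<Longrightarrow> evals p d x z \<Longrightarrow> evals p (Tup c d) x (prod_encode (y, z))"
| evals_Comp: "evals p d x y \<Longrightarrow> evals p c y z \<Longrightarrow> evals p (Comp c d) x z"
| evals_Prec_0: "evals p c x y \<Longrightarrow> evals p (Prec c d) (prod_encode (x, 0)) y"
| evals_Prec_Suc:
    "evals p (Prec c d) (prod_encode (x, n)) y \<Longrightarrow>
     evals p d (prod_encode (x, prod_encode (n, y))) z \<Longrightarrow>
     evals p (Prec c d) (prod_encode (x, Suc n)) z"
| evals_Mu: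
    "evals p c (prod_encode (x, k)) 0 \<Longrightarrow>
     (\<And>j. j < k \<Longrightarrow> \<exists>v. evals p c (prod_encode (x, j)) (Suc v)) \<Longrightarrow>
     evals p (Mu c) x k"

text \<open>
  A program has to be correct on the domain of \<open>F\<close> only; outside it may or may not halt.
\<close>

definition computable :: "(baire \<rightharpoonup> baire) \<Rightarrow> bool" where
  "computable F \<longleftrightarrow> (\<exists>c. \<forall>p q. F p = Some q \<longrightarrow> (\<forall>n. evals p c n (q n)))"

definition join :: "baire \<Rightarrow> baire \<Rightarrow> baire" where
  "join p q n = (if even n then p (n div 2) else q (n div 2))"

definition column :: "baire \<Rightarrow> nat \<Rightarrow> baire" where
  "column p i n = p (prod_encode (i, n))"


section \<open>Represented spaces, problems and Weihrauch reducibility\<close>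

text \<open>
  A represented space is given by its partial surjection; its carrier is the range of that map.
  A problem is a partial multivalued function between represented spaces, whose domain consists of
  the points \<open>x\<close> of the input space with \<open>val f x \<noteq> {}\<close>. The values of \<open>val f\<close> at elements of the
  type \<open>'x\<close> without a name play no role.
\<close>

type_synonym 'x repr = "baire \<rightharpoonup> 'x"

record ('x, 'y) problem =
  in_rep :: "'x repr"
  out_rep :: "'y repr"
  val :: "'x \<Rightarrow> 'y set"

definition realizes :: "(baire \<rightharpoonup> baire) \<Rightarrow> ('x, 'y) problem \<Rightarrow> bool" where
  "realizes F f \<longleftrightarrow>
    (\<forall>p x. in_rep f p = Some x \<and> val f x \<noteq> {} \<longrightarrow>
       (\<exists>q y. F p = Some q \<and> out_rep f q = Some y \<and> y \<in> val f x))"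

definition weihrauch_le :: "('x, 'y) problem \<Rightarrow> ('u, 'v) problem \<Rightarrow> bool"  (infix "\<le>\<^sub>W" 50) where
  "f \<le>\<^sub>W g \<longleftrightarrow>
    (\<exists>H K. computable H \<and> computable K \<and>
       (\<forall>G. realizes G g \<longrightarrow>
          realizes (\<lambda>p. Option.bind (H p) (\<lambda>h. Option.bind (G h) (\<lambda>q. K (join p q)))) f))"

definition weihrauch_equiv :: "('x, 'y) problem \<Rightarrow> ('u, 'v) problem \<Rightarrow> bool"  (infix "\<equiv>\<^sub>W" 50) where
  "f \<equiv>\<^sub>W g \<longleftrightarrow> f \<le>\<^sub>W g \<and> g \<le>\<^sub>W f"

definition weihrauch_less :: "('x, 'y) problem \<Rightarrow> ('u, 'v) problem \<Rightarrow> bool"  (infix "<\<^sub>W" 50) where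
  "f <\<^sub>W g \<longleftrightarrow> f \<le>\<^sub>W g \<and> \<not> g \<le>\<^sub>W f"

definition seq_rep :: "'x repr \<Rightarrow> (nat \<Rightarrow> 'x) repr" where
  "seq_rep \<delta> p =
    (if \<forall>i. column p i \<in> dom \<delta> then Some (\<lambda>i. the (\<delta> (column p i))) else None)"

definition parallelization :: "('x, 'y) problem \<Rightarrow> (nat \<Rightarrow> 'x, nat \<Rightarrow> 'y) problem" where
  "parallelization f =
    \<lparr>in_rep = seq_rep (in_rep f), out_rep = seq_rep (out_rep f),
     val = (\<lambda>x. {y. \<forall>i. y i \<in> val f (x i)})\<rparr>"


section \<open>Trees and names of sets\<close>

definition is_tree :: "'a list set \<Rightarrow> bool" where
  "is_tree T \<longleftrightarrow> (\<forall>\<sigma> \<tau>. \<tau> \<in> T \<and> prefix \<sigma> \<tau> \<longrightarrow> \<sigma> \<in> T)"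

definition paths :: "'a list set \<Rightarrow> (nat \<Rightarrow> 'a) set" where
  "paths T = {x. \<forall>n. map x [0..<n] \<in> T}"

definition baire_rep :: "baire repr" where
  "baire_rep p = Some p"

definition nat_rep :: "nat repr" where
  "nat_rep p = Some (p 0)"

text \<open>The set \<open>{0, 1}\<close> is rendered as \<^typ>\<open>bool\<close>, with \<open>1\<close> being \<^const>\<open>True\<close>.\<close>

definition bool_rep :: "bool repr" where
  "bool_rep p = (if p 0 \<in> {0, 1} then Some (p 0 = 1) else None)"

definition cantor_rep :: "(nat \<Rightarrow> bool) repr" where
  "cantor_rep p = (if range p \<subseteq> {0, 1} then Some (\<lambda>n. p n = 1) else None)"

definition char_rep :: "nat set repr" where
  "char_rep p = map_option Collect (cantor_rep p)"

definition tree_rep :: "nat list set repr" where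
  "tree_rep p =
    (case char_rep p of
       None \<Rightarrow> None
     | Some S \<Rightarrow> (let T = {\<sigma>. list_encode \<sigma> \<in> S} in if is_tree T then Some T else None))"

definition closed_rep :: "baire set repr" where
  "closed_rep p = map_option paths (tree_rep p)"

text \<open>
  In the next two definitions \<open>e\<close> identifies the countable set \<open>D\<close>, which is all of the type \<open>'d\<close>,
  with a set of natural numbers. Columns of the name whose index is not in the range of \<open>e\<close> (this
  occurs for \<open>D = {0, 1}\<close>) are ignored.
\<close>

definition sigma11_rep :: "('d \<Rightarrow> nat) \<Rightarrow> 'd set repr" where
  "sigma11_rep e p =
    (if \<forall>d. column p (e d) \<in> dom tree_rep
     then Some {d. paths (the (tree_rep (column p (e d)))) \<noteq> {}} else None)"

definition pi11_rep :: "('d \<Rightarrow> nat) \<Rightarrow> 'd set repr" where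
  "pi11_rep e p =
    (if \<forall>d. column p (e d) \<in> dom tree_rep
     then Some {d. paths (the (tree_rep (column p (e d)))) = {}} else None)"

text \<open>Bijective base-2 numeration, least significant digit first.\<close>

fun bin_encode :: "bool list \<Rightarrow> nat" where
  "bin_encode [] = 0"
| "bin_encode (b # \<sigma>) = 2 * bin_encode \<sigma> + (if b then 2 else 1)"

definition prod_rep :: "'x repr \<Rightarrow> 'y repr \<Rightarrow> ('x \<times> 'y) repr" where
  "prod_rep \<delta> \<epsilon> p =
    (case (\<delta> (\<lambda>n. p (2 * n)), \<epsilon> (\<lambda>n. p (2 * n + 1))) of
       (Some x, Some y) \<Rightarrow> Some (x, y)
     | _ \<Rightarrow> None)"

lemma bij_bin_encode: "bij bin_encode"
proof (rule bijI)
  have "bin_encode \<sigma> = bin_encode \<tau> \<Longrightarrow> \<sigma> = \<tau>" for \<sigma> \<tau>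
  proof (induction \<sigma> arbitrary: \<tau>)
    case Nil
    then show ?case by (cases \<tau>) (auto split: if_splits)
  next
    case (Cons b \<sigma>)
    then obtain c \<tau>' where \<tau>: "\<tau> = c # \<tau>'"
      by (cases \<tau>) (auto split: if_splits)
    with Cons.prems have "b = c \<and> bin_encode \<sigma> = bin_encode \<tau>'"
      by (auto split: if_splits) presburger+
    with Cons.IH \<tau> show ?case by auto
  qed
  then show "inj bin_encode" by (auto intro: injI)
  have "\<exists>\<sigma>. bin_encode \<sigma> = n" for n
  proof (induction n rule: less_induct)
    case (less n)
    show ?case
    proof (cases "n = 0")
      case True
      then show ?thesis by (auto intro: exI[of _ "[]"])
    next
      case False
      then obtain \<sigma> where "bin_encode \<sigma> = (n - 1) div 2"
        using less.IH[of "(n - 1) div 2"] by fastforce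
      with False have "bin_encode (even n # \<sigma>) = n"
        by (auto elim!: evenE oddE)
      then show ?thesis ..
    qed
  qed
  then show "surj bin_encode" by (metis surjI surj_def)
qed

lemma closed_paths: "closed (paths (T :: nat list set))"
proof -
  have "open {x :: baire. map x [0..<n] \<notin> T}" for n
  proof (subst open_subopen, safe)
    fix x :: baire
    assume x: "map x [0..<n] \<notin> T"
    let ?U = "\<Inter>i<n. {y :: baire. y i = x i}"
    have "open {y :: baire. y i = x i}" for i
      using open_vimage[OF open_discrete[of "{x i}"], of "\<lambda>y :: baire. y i"]
      by (simp add: vimage_def continuous_on_product_coordinates)
    then have "open ?U" by (intro open_INT) auto
    moreover have "?U \<subseteq> {x. map x [0..<n] \<notin> T}"
    proof safe
      fix y :: baire
      assume y: "y \<in> ?U" "map y [0..<n] \<in> T"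
      then have "map y [0..<n] = map x [0..<n]" by simp
      with x y show False by simp
    qed
    ultimately show "\<exists>U. open U \<and> x \<in> U \<and> U \<subseteq> {x. map x [0..<n] \<notin> T}"
      by (intro exI[of _ ?U]) auto
  qed
  then have "open (\<Union>n. {x :: baire. map x [0..<n] \<notin> T})" by auto
  moreover have "- paths T = (\<Union>n. {x. map x [0..<n] \<notin> T})"
    by (auto simp: paths_def)
  ultimately show ?thesis by (simp add: closed_def)
qed

lemma ex_tree_of_closed:
  fixes A :: "baire set"
  assumes "closed A"
  shows "\<exists>T. is_tree T \<and> paths T = A"
proof -
  define T where "T = {map x [0..<n] | x n. x \<in> A}"
  have "is_tree T"
    unfolding is_tree_def
  proof (intro allI impI, elim conjE)
    fix \<sigma> \<tau> :: "nat list"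
    assume "\<tau> \<in> T" "prefix \<sigma> \<tau>"
    then obtain x n where x: "x \<in> A" "\<tau> = map x [0..<n]" by (auto simp: T_def)
    with \<open>prefix \<sigma> \<tau>\<close> have l: "length \<sigma> \<le> n" using prefix_length_le by fastforce
    have "\<sigma> = take (length \<sigma>) \<tau>" using \<open>prefix \<sigma> \<tau>\<close> by (auto simp: prefix_def)
    also have "\<dots> = map x [0..<length \<sigma>]" using x l by (simp add: take_map)
    finally show "\<sigma> \<in> T" using x unfolding T_def by blast
  qed
  moreover have "paths T = A"
  proof (intro equalityI subsetI)
    fix x assume "x \<in> A"
    then show "x \<in> paths T" by (auto simp: paths_def T_def)
  next
    fix x assume x: "x \<in> paths T"
    have "\<exists>y\<in>A. \<forall>i<n. y i = x i" for n
    proof -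
      obtain y m where y: "y \<in> A" "map x [0..<n] = map y [0..<m]"
        using x unfolding paths_def T_def by blast
      then have "m = n" using map_eq_imp_length_eq by fastforce
      with y show ?thesis by (auto simp: list_eq_iff_nth_eq)
    qed
    then obtain y where y: "\<And>n. y n \<in> A" "\<And>n i. i < n \<Longrightarrow> y n i = x i" by metis
    have "(\<lambda>n. y n i) \<longlonglongrightarrow> x i" for i
    proof (rule tendsto_eventually)
      show "eventually (\<lambda>n. y n i = x i) sequentially"
        using eventually_gt_at_top[of i] by eventually_elim (use y in auto)
    qed
    then have "y \<longlonglongrightarrow> x"
      using limitin_componentwise[of "\<lambda>_. euclidean" "UNIV :: nat set" y x sequentially]
      by (simp add: euclidean_product_topology)
    with y assms show "x \<in> A"
      by (auto intro: Lim_in_closed_set[where F = sequentially and f = y])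
  qed
  ultimately show ?thesis by blast
qed

lemma ran_closed_rep: "ran closed_rep = {A. closed A}"
proof (intro equalityI subsetI)
  fix A assume "A \<in> ran closed_rep"
  then show "A \<in> {A. closed A}" by (auto simp: ran_def closed_rep_def closed_paths)
next
  fix A :: "baire set" assume "A \<in> {A. closed A}"
  then obtain T where T: "is_tree T" "paths T = A" using ex_tree_of_closed by auto
  let ?p = "\<lambda>n. of_bool (list_decode n \<in> T) :: nat"
  have "tree_rep ?p = Some T"
    using T by (auto simp: tree_rep_def char_rep_def cantor_rep_def Let_def)
  with T show "A \<in> ran closed_rep" by (auto simp: ran_def closed_rep_def intro!: exI[of _ ?p])
qed


section \<open>The problems\<close>

definition C_NN :: "(baire set, baire) problem" where
  "C_NN = \<lparr>in_rep = closed_rep, out_rep = baire_rep, val = (\<lambda>A. A)\<rparr>"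

definition UC_NN :: "(baire set, baire) problem" where
  "UC_NN = \<lparr>in_rep = closed_rep, out_rep = baire_rep,
    val = (\<lambda>A. if is_singleton A then A else {})\<rparr>"

definition Sigma11_C_2 :: "(bool set, bool) problem" where
  "Sigma11_C_2 = \<lparr>in_rep = sigma11_rep of_bool, out_rep = bool_rep, val = (\<lambda>S. S)\<rparr>"

definition Sigma11_C_N :: "(nat set, nat) problem" where
  "Sigma11_C_N = \<lparr>in_rep = sigma11_rep id, out_rep = nat_rep, val = (\<lambda>S. S)\<rparr>"

definition Pi11_Sep :: "(nat set \<times> nat set, nat set) problem" where
  "Pi11_Sep = \<lparr>in_rep = prod_rep (pi11_rep id) (pi11_rep id), out_rep = char_rep,
    val = (\<lambda>(A, B). if A \<inter> B = {} then {C. A \<subseteq> C \<and> B \<inter> C = {}} else {})\<rparr>"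

definition Sigma11_WKL :: "(bool list set, nat \<Rightarrow> bool) problem" where
  "Sigma11_WKL = \<lparr>in_rep = sigma11_rep bin_encode, out_rep = cantor_rep,
    val = (\<lambda>T. if is_tree T \<and> infinite T then paths T else {})\<rparr>"

end

theory Submission
  imports Defs
begin

text \<open>
  The reductions rest on a normal form: if \<open>Q\<close> is primitive recursive in an oracle, then a tree whose
  paths are the \<open>y\<close> with \<open>\<forall>n. Q (join p y) n\<close> is primitive recursive in \<open>p\<close>, since \<open>Q\<close> can be
  evaluated on finite prefixes of \<open>y\<close>. The only reduction that needs more than this is
  that of \<open>Sigma11_WKL\<close> to binary choice: whether to continue a path by one bit or the other is decided by
  comparing the ranks of the two trees of witnesses, where \<open>rank S \<le> rank T\<close> (existence of a length and
  prefix preserving map from \<open>S\<close> to \<open>T\<close>) is \<open>\<Sigma>\<^sup>1\<^sub>1\<close> and total.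

  The separations are topological. A computable function is continuous on its domain, and, since
  membership of a node in a tree may depend on the part of the name already written, there is for any
  closed relation \<open>R\<close> a name \<open>p\<close> of a tree with paths \<open>{y. R p y}\<close>. Such self-referential instances
  defeat a given pair \<open>H\<close>, \<open>K\<close>, again by comparing ranks of trees.
\<close>

section \<open>Programs\<close>

text \<open>An instance of choice must have a solution whatever is asked. Of two trees one always
  maps into the other, so a question put as a comparison is legitimate even if neither tree has a
  path; and as such a map carries paths to paths, the answer is right if exactly one tree has a
  path. In the separations this makes the instance valid before anything is known about
  \<open>H\<close> and \<open>K\<close>, so that the reduction can be applied to it.

  The relation "the answer obtained from y is d" need not be closed, because \<open>H\<close> and
  \<open>K\<close> are partial. It is replaced by its closure in both the name and y. Continuity of
  \<open>H\<close> and \<open>K\<close> at the constructed name, where the reduction guarantees that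
  they are defined, shows that the closure adds no harmful points there.

  A reduction has to cope with every name, noncomputable ones included. Hence a fixed point of an
  operator on names, each value of which depends on earlier values only, can take the place of the
  recursion theorem.\<close>

definition agree :: "nat \<Rightarrow> baire \<Rightarrow> baire \<Rightarrow> bool" where
  "agree n p q \<longleftrightarrow> (\<forall>i<n. p i = q i)"

lemma agree_refl [simp]: "agree n p p"
  by (simp add: agree_def)

lemma agree_sym: "agree n p q \<Longrightarrow> agree n q p"
  by (simp add: agree_def)

lemma agree_trans: "agree n p q \<Longrightarrow> agree n q r \<Longrightarrow> agree n p r"
  by (simp add: agree_def)

lemma agree_mono: "agree n p q \<Longrightarrow> m \<le> n \<Longrightarrow> agree m p q"
  by (simp add: agree_def)

lemma agreeD: "agree n p q \<Longrightarrow> i < n \<Longrightarrow> p i = q i"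
  by (simp add: agree_def)

inductive_cases evals_elims:
  "evals p Zero x y" "evals p Succ x y" "evals p Fst x y" "evals p Snd x y" "evals p Query x y"
  "evals p (Tup c d) x y" "evals p (Comp c d) x y" "evals p (Prec c d) x y" "evals p (Mu c) x y"

lemma evals_det:
  assumes "evals p c x y" "evals p c x z"
  shows "y = z"
  using assms
proof (induction arbitrary: z rule: evals.induct)
  case (evals_Prec_0 c x y d)
  from evals_Prec_0.prems have "evals p c x z"
    by (cases rule: evals.cases) auto
  then show ?case by (rule evals_Prec_0.IH)
next
  case (evals_Prec_Suc c d x n y u)
  from evals_Prec_Suc.prems obtain y' where "evals p (Prec c d) (prod_encode (x, n)) y'"
      "evals p d (prod_encode (x, prod_encode (n, y'))) z"
    by (cases rule: evals.cases) auto
  with evals_Prec_Suc.IH show ?case by blast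
next
  case (evals_Mu c x k)
  from evals_Mu.prems have z: "evals p c (prod_encode (x, z)) 0"
      "\<And>j. j < z \<Longrightarrow> \<exists>v. evals p c (prod_encode (x, j)) (Suc v)"
    by (auto elim: evals_elims(9))
  show ?case
  proof (rule linorder_cases[of k z])
    assume "k < z"
    with z(2) evals_Mu.IH show ?thesis by fastforce
  next
    assume "z < k"
    with z(1) evals_Mu.IH show ?thesis by fastforce
  qed
qed (blast elim: evals_elims | fastforce elim: evals_elims)+

text \<open>The use principle: a halting computation queries its oracle finitely often. The bound is
  stated as an eventual property so that the bounds of subcomputations need not be combined by hand;
  for \<open>Mu\<close> there are finitely many of them below k.\<close>

lemma evals_use:
  assumes "evals p c x y"
  shows "\<forall>\<^sub>F N in sequentially. \<forall>q. agree N p q \<longrightarrow> evals q c x y"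
  using assms
proof (induction rule: evals.induct)
  case (evals_Query x)
  show ?case
    using eventually_gt_at_top[of x]
    by eventually_elim (metis agreeD evals.evals_Query)
next
  case (evals_Tup c x y d z)
  from evals_Tup.IH show ?case
    by eventually_elim (blast intro: evals.intros)
next
  case (evals_Comp d x y c z)
  from evals_Comp.IH show ?case
    by eventually_elim (blast intro: evals.intros)
next
  case (evals_Prec_0 c x y d)
  from evals_Prec_0.IH show ?case
    by eventually_elim (blast intro: evals.intros)
next
  case (evals_Prec_Suc c d x n y z)
  from evals_Prec_Suc.IH show ?case
    by eventually_elim (blast intro: evals.intros)
next
  case (evals_Mu c x k)
  have "\<forall>\<^sub>F N in sequentially.
      \<forall>j\<in>{..<k}. \<exists>v. \<forall>q. agree N p q \<longrightarrow> evals q c (prod_encode (x, j)) (Suc v)"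
  proof (rule eventually_ball_finite, simp, intro ballI)
    fix j assume "j \<in> {..<k}"
    with evals_Mu.IH obtain v where
      "\<forall>\<^sub>F N in sequentially. \<forall>q. agree N p q \<longrightarrow> evals q c (prod_encode (x, j)) (Suc v)"
      by auto
    then show "\<forall>\<^sub>F N in sequentially.
        \<exists>v. \<forall>q. agree N p q \<longrightarrow> evals q c (prod_encode (x, j)) (Suc v)"
      by eventually_elim blast
  qed
  with evals_Mu.IH(1) show ?case
    by eventually_elim (metis evals.evals_Mu lessThan_iff)
qed (simp_all add: evals.intros)

text \<open>The program is correct on the domain of F only. It still halts with the old value at
  every nearby p', but this says something about F only if \<open>F p'\<close> is defined.\<close>

lemma computable_continuous:
  assumes "computable F" "F p = Some q"
  shows "\<forall>\<^sub>F N in sequentially. \<forall>p' q'. agree N p p' \<and> F p' = Some q' \<longrightarrow> q' n = q n"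
proof -
  obtain c where c: "\<And>p q n. F p = Some q \<Longrightarrow> evals p c n (q n)"
    using assms(1) by (auto simp: computable_def)
  from evals_use[OF c[OF assms(2), of n]] show ?thesis
    by eventually_elim (meson c evals_det)
qed

primrec subst :: "prog \<Rightarrow> prog \<Rightarrow> prog" where
  "subst e Zero = Zero"
| "subst e Succ = Succ"
| "subst e Fst = Fst"
| "subst e Snd = Snd"
| "subst e Query = e"
| "subst e (Tup c d) = Tup (subst e c) (subst e d)"
| "subst e (Comp c d) = Comp (subst e c) (subst e d)"
| "subst e (Prec c d) = Prec (subst e c) (subst e d)"
| "subst e (Mu c) = Mu (subst e c)"

lemma evals_subst:
  assumes "evals q c x y" "\<And>k. evals p e k (q k)"
  shows "evals p (subst e c) x y"
  using assms(1)
proof (induction rule: evals.induct)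
  case (evals_Mu c x k)
  then show ?case unfolding subst.simps by (intro evals.evals_Mu) blast+
qed (auto intro: evals.intros assms(2))

lemma computable_bind:
  assumes "computable F" "computable G"
  shows "computable (\<lambda>p. Option.bind (F p) G)"
proof -
  obtain c d where c: "\<And>p q n. F p = Some q \<Longrightarrow> evals p c n (q n)"
    and d: "\<And>p q n. G p = Some q \<Longrightarrow> evals p d n (q n)"
    using assms unfolding computable_def by metis
  have "evals p (subst c d) n (r n)" if "Option.bind (F p) G = Some r" for p r n
    using that by (auto simp: bind_eq_Some_conv intro: evals_subst[OF d] c)
  then show ?thesis by (auto simp: computable_def)
qed

section \<open>Functionals that are primitive recursive in the oracle\<close>

abbreviation pfst :: "nat \<Rightarrow> nat" where "pfst x \<equiv> fst (prod_decode x)"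
abbreviation psnd :: "nat \<Rightarrow> nat" where "psnd x \<equiv> snd (prod_decode x)"

text \<open>A semantic class of total functionals. Rule induction over it gives
  \<open>pr_program\<close> and \<open>ex_approximates\<close>, while its closure properties,
  collected in \<open>pr_intros\<close>, settle computability claims without programs being written
  down.\<close>

inductive pr :: "(baire \<Rightarrow> nat \<Rightarrow> nat) \<Rightarrow> bool" where
  pr_zero: "pr (\<lambda>p x. 0)"
| pr_succ: "pr (\<lambda>p x. Suc x)"
| pr_pfst: "pr (\<lambda>p x. pfst x)"
| pr_psnd: "pr (\<lambda>p x. psnd x)"
| pr_oracle: "pr (\<lambda>p x. p x)"
| pr_pair: "pr f \<Longrightarrow> pr g \<Longrightarrow> pr (\<lambda>p x. prod_encode (f p x, g p x))"
| pr_comp: "pr f \<Longrightarrow> pr g \<Longrightarrow> pr (\<lambda>p x. f p (g p x))"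
| pr_prec: "pr f \<Longrightarrow> pr g \<Longrightarrow>
    pr (\<lambda>p x. rec_nat (f p (pfst x)) (\<lambda>n y. g p (prod_encode (pfst x, prod_encode (n, y)))) (psnd x))"

lemma pr_program:
  assumes "pr f"
  shows "\<exists>c. \<forall>p x. evals p c x (f p x)"
  using assms
proof (induction rule: pr.induct)
  case pr_pfst
  have "evals p Fst x (pfst x)" for p x
    using evals_Fst[of p "pfst x" "psnd x"] by simp
  then show ?case by blast
next
  case pr_psnd
  have "evals p Snd x (psnd x)" for p x
    using evals_Snd[of p "pfst x" "psnd x"] by simp
  then show ?case by blast
next
  case (pr_prec f g)
  then obtain c d where c: "\<And>p x. evals p c x (f p x)" and d: "\<And>p x. evals p d x (g p x)"
    by blast
  have "evals p (Prec c d) (prod_encode (a, m))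
      (rec_nat (f p a) (\<lambda>n y. g p (prod_encode (a, prod_encode (n, y)))) m)" for p a m
    by (induction m) (auto intro: c d evals.intros)
  then have "evals p (Prec c d) x
      (rec_nat (f p (pfst x)) (\<lambda>n y. g p (prod_encode (pfst x, prod_encode (n, y)))) (psnd x))" for p x
    by (metis prod.collapse prod_decode_inverse)
  then show ?case by blast
qed (blast intro: evals.intros)+

lemma computable_pr: "pr f \<Longrightarrow> computable (\<lambda>p. Some (f p))"
  using pr_program[of f] by (auto simp: computable_def)

text \<open>The one unbounded search in the reductions: it recovers a number from a list of
  yes-or-no answers in \<open>UC_le_C_2\<close>.\<close>

lemma computable_Mu:
  assumes "pr f"
  shows "computable (\<lambda>p. if \<forall>x. \<exists>k. f p (prod_encode (x, k)) = 0
    then Some (\<lambda>x. LEAST k. f p (prod_encode (x, k)) = 0) else None)"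
proof -
  obtain c where c: "\<And>p x. evals p c x (f p x)"
    using pr_program[OF assms] by blast
  have "evals p (Mu c) x (LEAST k. f p (prod_encode (x, k)) = 0)"
    if "\<forall>x. \<exists>k. f p (prod_encode (x, k)) = 0" for p x
  proof (rule evals_Mu)
    show "evals p c (prod_encode (x, LEAST k. f p (prod_encode (x, k)) = 0)) 0"
      using c[of p] LeastI_ex[OF that[rule_format, of x]] by metis
    fix j assume "j < (LEAST k. f p (prod_encode (x, k)) = 0)"
    then have "f p (prod_encode (x, j)) \<noteq> 0" by (rule not_less_Least)
    then show "\<exists>v. evals p c (prod_encode (x, j)) (Suc v)"
      using c[of p] by (metis not0_implies_Suc)
  qed
  then show ?thesis by (auto simp: computable_def split: if_splits)
qed

text \<open>Allows a functional that produces trees to be run on one half of a joined oracle, as in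
  the nested construction of \<open>WKL_le_C_2\<close>.\<close>

lemma pr_oracle_subst:
  assumes "pr f" "pr h"
  shows "pr (\<lambda>p x. f (h p) x)"
  using assms(1)
proof (induction rule: pr.induct)
  case (pr_comp f g)
  from pr.pr_comp[OF pr_comp.IH] show ?case .
next
  case (pr_prec f g)
  from pr.pr_prec[OF pr_prec.IH] show ?case .
qed (simp_all add: pr.intros assms(2))

section \<open>Closure properties of the primitive recursive functionals\<close>

lemma pr_cong: "pr g \<Longrightarrow> (\<And>p x. f p x = g p x) \<Longrightarrow> pr f"
  by presburger

lemma pr_id: "pr (\<lambda>p x. x)"
  using pr_pair[OF pr_pfst pr_psnd] by simp

lemma pr_const: "pr (\<lambda>p x. n)"
  by (induction n) (auto intro: pr_zero pr_comp[OF pr_succ, simplified])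

lemma pr_Suc: "pr f \<Longrightarrow> pr (\<lambda>p x. Suc (f p x))"
  by (rule pr_comp[OF pr_succ])

lemma pr_fst: "pr f \<Longrightarrow> pr (\<lambda>p x. pfst (f p x))"
  by (rule pr_comp[OF pr_pfst])

lemma pr_snd: "pr f \<Longrightarrow> pr (\<lambda>p x. psnd (f p x))"
  by (rule pr_comp[OF pr_psnd])

lemma pr_query: "pr f \<Longrightarrow> pr (\<lambda>p x. p (f p x))"
  by (rule pr_comp[OF pr_oracle])

lemma pr_rec:
  assumes "pr a" "pr (\<lambda>p z. g p (pfst z) (pfst (psnd z)) (psnd (psnd z)))" "pr k"
  shows "pr (\<lambda>p x. rec_nat (a p x) (\<lambda>n y. g p x n y) (k p x))"
  using pr_comp[OF pr_prec[OF assms(1,2)] pr_pair[OF pr_id assms(3)]] by simp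

named_theorems pr_intros

lemmas [pr_intros] = pr_const pr_id pr_Suc pr_fst pr_snd pr_query pr_pair

lemma pr_add [pr_intros]:
  assumes "pr f" "pr g"
  shows "pr (\<lambda>p x. f p x + g p x)"
proof -
  have "rec_nat a (\<lambda>n y. Suc y) b = a + b" for a b by (induction b) auto
  moreover have "pr (\<lambda>p x. rec_nat (f p x) (\<lambda>n y. Suc y) (g p x))"
    by (intro pr_rec pr_intros assms)
  ultimately show ?thesis by simp
qed

lemma pr_mult [pr_intros]:
  assumes "pr f" "pr g"
  shows "pr (\<lambda>p x. f p x * g p x)"
proof -
  have "rec_nat 0 (\<lambda>n y. y + a) b = a * b" for a b :: nat by (induction b) auto
  moreover have "pr (\<lambda>p x. rec_nat 0 (\<lambda>n y. y + f p x) (g p x))"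
    by (intro pr_rec pr_intros pr_comp[OF assms(1)] assms)
  ultimately show ?thesis by simp
qed

lemma pr_pow2 [pr_intros]:
  assumes "pr f"
  shows "pr (\<lambda>p x. 2 ^ f p x)"
proof -
  have "rec_nat 1 (\<lambda>n y. y * 2) b = (2 ^ b :: nat)" for b by (induction b) auto
  moreover have "pr (\<lambda>p x. rec_nat 1 (\<lambda>n y. y * 2) (f p x))"
    by (intro pr_rec pr_intros assms)
  ultimately show ?thesis by simp
qed

lemma pr_minus [pr_intros]:
  assumes "pr f" "pr g"
  shows "pr (\<lambda>p x. f p x - g p x)"
proof -
  have "rec_nat 0 (\<lambda>n y. n) b = b - 1" for b :: nat by (induction b) auto
  moreover have "pr (\<lambda>p x. rec_nat 0 (\<lambda>n y. n) x)"
    by (intro pr_rec pr_intros)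
  ultimately have *: "pr (\<lambda>p x. x - 1)" by simp
  have "rec_nat a (\<lambda>n y. y - 1) b = a - b" for a b :: nat by (induction b) auto
  moreover have "pr (\<lambda>p x. rec_nat (f p x) (\<lambda>n y. y - 1) (g p x))"
    by (intro pr_rec pr_intros pr_comp[OF *] assms)
  ultimately show ?thesis by simp
qed

lemma pr_mod2 [pr_intros]:
  assumes "pr f"
  shows "pr (\<lambda>p x. f p x mod 2)"
proof -
  have "rec_nat 0 (\<lambda>n y. 1 - y) b = b mod 2" for b :: nat
    by (induction b) (auto, presburger)
  moreover have "pr (\<lambda>p x. rec_nat 0 (\<lambda>n y. 1 - y) (f p x))"
    by (intro pr_rec pr_intros assms)
  ultimately show ?thesis by simp
qed

lemma pr_div2 [pr_intros]:
  assumes "pr f"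
  shows "pr (\<lambda>p x. f p x div 2)"
proof -
  have "rec_nat 0 (\<lambda>n y. y + n mod 2) b = b div 2" for b :: nat
    by (induction b) (auto, presburger)
  moreover have "pr (\<lambda>p x. rec_nat 0 (\<lambda>n y. y + n mod 2) (f p x))"
    by (intro pr_rec pr_intros assms)
  ultimately show ?thesis by simp
qed

definition prd :: "(baire \<Rightarrow> nat \<Rightarrow> bool) \<Rightarrow> bool" where
  "prd Q \<longleftrightarrow> pr (\<lambda>p x. of_bool (Q p x))"

lemma pr_if [pr_intros]:
  assumes "prd Q" "pr f" "pr g"
  shows "pr (\<lambda>p x. if Q p x then f p x else g p x)"
proof -
  have *: "pr (\<lambda>p x. of_bool (Q p x) * f p x + (1 - of_bool (Q p x)) * g p x)"
    using assms unfolding prd_def by (intro pr_intros)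
  show ?thesis by (rule pr_cong[OF *]) simp
qed

lemma pr_of_bool [pr_intros]: "prd Q \<Longrightarrow> pr (\<lambda>p x. of_bool (Q p x))"
  by (simp add: prd_def)

lemma prd_not [pr_intros]:
  assumes "prd Q"
  shows "prd (\<lambda>p x. \<not> Q p x)"
proof -
  have *: "pr (\<lambda>p x. 1 - of_bool (Q p x))" by (intro pr_intros assms)
  show ?thesis unfolding prd_def by (rule pr_cong[OF *]) simp
qed

lemma prd_le [pr_intros]:
  assumes "pr f" "pr g"
  shows "prd (\<lambda>p x. f p x \<le> g p x)"
proof -
  have *: "pr (\<lambda>p x. 1 - (f p x - g p x))" by (intro pr_intros assms)
  show ?thesis unfolding prd_def by (rule pr_cong[OF *]) auto
qed

lemma prd_less [pr_intros]: "pr f \<Longrightarrow> pr g \<Longrightarrow> prd (\<lambda>p x. f p x < g p x)"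
  using prd_le[of "\<lambda>p x. Suc (f p x)" g] by (simp add: Suc_le_eq pr_Suc)

lemma prd_conj [pr_intros]:
  assumes "prd Q" "prd R"
  shows "prd (\<lambda>p x. Q p x \<and> R p x)"
proof -
  have *: "pr (\<lambda>p x. of_bool (Q p x) * of_bool (R p x))" by (intro pr_intros assms)
  show ?thesis unfolding prd_def by (rule pr_cong[OF *]) simp
qed

lemma prd_disj [pr_intros]: "prd Q \<Longrightarrow> prd R \<Longrightarrow> prd (\<lambda>p x. Q p x \<or> R p x)"
  using prd_not[OF prd_conj[OF prd_not[of Q] prd_not[of R]]] by simp

lemma prd_imp [pr_intros]: "prd Q \<Longrightarrow> prd R \<Longrightarrow> prd (\<lambda>p x. Q p x \<longrightarrow> R p x)"
  unfolding imp_conv_disj by (intro prd_disj prd_not)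

lemma prd_eq [pr_intros]: "pr f \<Longrightarrow> pr g \<Longrightarrow> prd (\<lambda>p x. f p x = g p x)"
  using prd_conj[OF prd_le prd_le, of f g g f] by (simp add: eq_iff)

lemma prd_all_less [pr_intros]:
  assumes "prd (\<lambda>p z. Q p (pfst z) (psnd z))" "pr k"
  shows "prd (\<lambda>p x. \<forall>i<k p x. Q p x i)"
proof -
  have "rec_nat 1 (\<lambda>n y. y * of_bool (P n)) m = (of_bool (\<forall>i<m. P i) :: nat)" for P m
    by (induction m) (auto simp: less_Suc_eq)
  moreover have "pr (\<lambda>p x. rec_nat 1 (\<lambda>n y. y * of_bool (Q p x n)) (k p x))"
    using pr_comp[OF assms(1)[unfolded prd_def] pr_pair[OF pr_pfst pr_fst[OF pr_psnd]]]
    by (intro pr_rec pr_intros assms) (simp add: prd_def)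
  ultimately show ?thesis by (simp add: prd_def)
qed

text \<open>Codes of lists grow at the front, so the recursion starts with the last entry: after j
  steps it holds the code of the last j entries.\<close>

lemma pr_codes [pr_intros]:
  assumes "pr (\<lambda>p z. h p (pfst z) (psnd z))" "pr k"
  shows "pr (\<lambda>p x. list_encode (map (h p x) [0..<k p x]))"
proof -
  let ?g = "\<lambda>p x m. rec_nat 0 (\<lambda>n y. Suc (prod_encode (h p x (m - Suc n), y)))"
  have "rec_nat 0 (\<lambda>n y. Suc (prod_encode (f (m - Suc n), y))) j
      = list_encode (map f [m - j..<m])" if "j \<le> m" for f :: "nat \<Rightarrow> nat" and m j
    using that
  proof (induction j)
    case (Suc j)
    then have "[m - Suc j..<m] = (m - Suc j) # [m - j..<m]"
      by (subst upt_conv_Cons) (auto simp: Suc_diff_Suc)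
    with Suc show ?case by simp
  qed simp
  then have *: "list_encode (map (h p x) [0..<k p x]) = ?g p x (k p x) (k p x)" for p x
    by simp
  have "pr (\<lambda>p x. ?g p x (k p x) (k p x))"
    using pr_comp[OF assms(1) pr_pair[OF pr_pfst pr_minus[OF pr_comp[OF assms(2) pr_pfst]
        pr_Suc[OF pr_fst[OF pr_psnd]]]]]
    by (intro pr_rec pr_intros assms) simp
  with * show ?thesis by simp
qed

section \<open>Operations on codes of finite sequences\<close>

definition ctl :: "nat \<Rightarrow> nat" where
  "ctl c = psnd (c - 1)"

definition cdrop :: "nat \<Rightarrow> nat \<Rightarrow> nat" where
  "cdrop i c = rec_nat c (\<lambda>_. ctl) i"

definition cnth :: "nat \<Rightarrow> nat \<Rightarrow> nat" where
  "cnth c i = pfst (cdrop i c - 1)"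

definition clen :: "nat \<Rightarrow> nat" where
  "clen c = length (list_decode c)"

lemma prod_decode_0: "prod_decode 0 = (0, 0)"
  by (simp add: prod_decode_def prod_decode_aux.simps)

text \<open>The code of a nonempty list is \<open>Suc\<close> of a pair, hence the
  \<open>c - 1\<close> in \<open>ctl\<close>; as \<open>prod_decode 0 = (0, 0)\<close>, the empty
  list is its own tail.\<close>

lemma ctl_encode: "ctl (list_encode s) = list_encode (tl s)"
  by (cases s) (auto simp: ctl_def prod_decode_0)

lemma cdrop_encode: "cdrop i (list_encode s) = list_encode (drop i s)"
  by (induction i) (auto simp: cdrop_def ctl_encode drop_Suc tl_drop)

lemma cnth_encode: "cnth (list_encode s) i = (if i < length s then s ! i else 0)"
  using Cons_nth_drop_Suc[of i s, symmetric]
  by (auto simp: cnth_def cdrop_encode prod_decode_0)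

lemma clen_encode [simp]: "clen (list_encode s) = length s"
  by (simp add: clen_def)

text \<open>Bounds the search for the length in \<open>pr_clen\<close>. It also places the entry for
  a node in the name of a tree at a position not below its length, on which
  \<open>ex_self_reference\<close> rests.\<close>

lemma length_le_encode: "length s \<le> list_encode s"
proof (induction s)
  case (Cons a s)
  have "list_encode s \<le> prod_encode (a, list_encode s)" by (rule le_prod_encode_2)
  with Cons show ?case by simp
qed simp

lemma pr_ctl: "pr f \<Longrightarrow> pr (\<lambda>p x. ctl (f p x))"
  unfolding ctl_def by (intro pr_intros)

lemma pr_cdrop: "pr f \<Longrightarrow> pr g \<Longrightarrow> pr (\<lambda>p x. cdrop (f p x) (g p x))"
  unfolding cdrop_def by (intro pr_rec pr_ctl pr_intros)

lemma pr_cnth [pr_intros]: "pr f \<Longrightarrow> pr g \<Longrightarrow> pr (\<lambda>p x. cnth (f p x) (g p x))"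
  unfolding cnth_def by (intro pr_cdrop pr_intros)

lemma pr_clen [pr_intros]:
  assumes "pr f"
  shows "pr (\<lambda>p x. clen (f p x))"
proof -
  \<comment> \<open>The length is the number of n below c for which dropping n entries leaves a
    nonempty list.\<close>
  let ?g = "\<lambda>c. rec_nat 0 (\<lambda>n y. y + of_bool (cdrop n c \<noteq> 0))"
  have "list_encode s \<noteq> 0 \<longleftrightarrow> s \<noteq> []" for s
    by (cases s) auto
  then have "?g (list_encode s) m = min m (length s)" for s m
    by (induction m) (auto simp: cdrop_encode)
  then have "?g c c = clen c" for c
    using length_le_encode[of "list_decode c"] by (metis clen_def list_decode_inverse min.absorb2)
  moreover have "pr (\<lambda>p x. ?g x x)"
    by (intro pr_rec pr_cdrop pr_intros)
  ultimately have "pr (\<lambda>p x. clen x)" by simp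
  from pr_comp[OF this assms] show ?thesis .
qed

section \<open>Trees of \<open>\<Pi>\<^sup>0\<^sub>1\<close> classes\<close>

lemma join_even [simp]: "join p q (2 * n) = p n"
  by (simp add: join_def)

lemma join_odd [simp]: "join p q (Suc (2 * n)) = q n"
  by (simp add: join_def)

lemma prefix_map_upt: "m \<le> n \<Longrightarrow> prefix (map y [0..<m]) (map y [0..<n])"
  by (metis le_add_diff_inverse map_append prefixI upt_add_eq_append zero_le)

text \<open>
  \<open>g\<close> simulates \<open>f\<close> on the oracle \<open>join p y\<close> when only a finite prefix of \<open>y\<close> is known;
  the value \<open>0\<close> signals that the prefix is too short.
\<close>

definition approximates :: "(baire \<Rightarrow> nat \<Rightarrow> nat) \<Rightarrow> (baire \<Rightarrow> nat \<Rightarrow> nat) \<Rightarrow> bool" where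
  "approximates g f \<longleftrightarrow>
    (\<forall>p s t x v. prefix s t \<and> g p (prod_encode (list_encode s, x)) = Suc v \<longrightarrow>
       g p (prod_encode (list_encode t, x)) = Suc v) \<and>
    (\<forall>p y x. \<forall>\<^sub>F n in sequentially.
       g p (prod_encode (list_encode (map y [0..<n]), x)) = Suc (f (join p y) x))"

lemma approximates_mono:
  "approximates g f \<Longrightarrow> prefix s t \<Longrightarrow> g p (prod_encode (list_encode s, x)) = Suc v \<Longrightarrow>
    g p (prod_encode (list_encode t, x)) = Suc v"
  unfolding approximates_def by blast

lemma approximates_lim:
  "approximates g f \<Longrightarrow> \<forall>\<^sub>F n in sequentially.
     g p (prod_encode (list_encode (map y [0..<n]), x)) = Suc (f (join p y) x)"
  unfolding approximates_def by blast

lemma approximates_sound: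
  assumes "approximates g f" "g p (prod_encode (list_encode (map y [0..<m]), x)) = Suc v"
  shows "f (join p y) x = v"
proof -
  have "\<forall>\<^sub>F n in sequentially. n \<ge> m" by (rule eventually_ge_at_top)
  with approximates_lim[OF assms(1), of p y x] have "\<forall>\<^sub>F n in sequentially. f (join p y) x = v"
  proof eventually_elim
    case (elim n)
    from approximates_mono[OF assms(1), OF prefix_map_upt[OF elim(2)] assms(2)] elim(1)
    show ?case by simp
  qed
  then show ?thesis by simp
qed

text \<open>Every part of f is run on the same prefix and a failure is passed on. Since f is total,
  a value depends on finitely many stages, each of which succeeds once the prefix is long
  enough.\<close>

lemma ex_approximates:
  assumes "pr f"
  shows "\<exists>g. pr g \<and> approximates g f"
  using assms
proof (induction rule: pr.induct)
  case pr_zero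
  show ?case
    by (intro exI[of _ "\<lambda>p z. Suc 0"] conjI pr_intros) (auto simp: approximates_def)
next
  case pr_succ
  show ?case
    by (intro exI[of _ "\<lambda>p z. Suc (Suc (psnd z))"] conjI pr_intros) (auto simp: approximates_def)
next
  case pr_pfst
  show ?case
    by (intro exI[of _ "\<lambda>p z. Suc (pfst (psnd z))"] conjI pr_intros) (auto simp: approximates_def)
next
  case pr_psnd
  show ?case
    by (intro exI[of _ "\<lambda>p z. Suc (psnd (psnd z))"] conjI pr_intros) (auto simp: approximates_def)
next
  case pr_oracle
  \<comment> \<open>Even positions of \<open>join p y\<close> belong to p and can always be read;
    odd ones need an entry of the prefix of y.\<close>
  let ?g = "\<lambda>p z. if psnd z mod 2 = 0 then Suc (p (psnd z div 2))
    else if psnd z div 2 < clen (pfst z) then Suc (cnth (pfst z) (psnd z div 2)) else 0"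
  have "approximates ?g (\<lambda>p x. p x)"
    unfolding approximates_def
  proof (intro conjI allI impI, elim conjE)
    fix p s t x v
    assume "prefix s t" "?g p (prod_encode (list_encode s, x)) = Suc v"
    then show "?g p (prod_encode (list_encode t, x)) = Suc v"
      by (auto simp: cnth_encode prefix_def nth_append split: if_splits)
  next
    fix p y x
    show "\<forall>\<^sub>F n in sequentially. ?g p (prod_encode (list_encode (map y [0..<n]), x)) = Suc (join p y x)"
      using eventually_gt_at_top[of x]
    proof eventually_elim
      case (elim n)
      then have "x div 2 < n" by simp
      then show ?case by (auto simp: cnth_encode join_def even_iff_mod_2_eq_zero)
    qed
  qed
  moreover have "pr ?g" by (intro pr_intros)
  ultimately show ?case by blast
next
  case (pr_pair f1 f2)
  then obtain g1 g2 where g: "pr g1" "approximates g1 f1" "pr g2" "approximates g2 f2" by blast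
  let ?g = "\<lambda>p z. if g1 p z = 0 \<or> g2 p z = 0 then 0 else Suc (prod_encode (g1 p z - 1, g2 p z - 1))"
  have "approximates ?g (\<lambda>p x. prod_encode (f1 p x, f2 p x))"
    unfolding approximates_def
  proof (intro conjI allI impI, elim conjE)
    fix p s t x v
    assume st: "prefix s t" and v: "?g p (prod_encode (list_encode s, x)) = Suc v"
    then obtain v1 v2 where "g1 p (prod_encode (list_encode s, x)) = Suc v1"
        "g2 p (prod_encode (list_encode s, x)) = Suc v2"
      by (metis not0_implies_Suc nat.distinct(1))
    with v approximates_mono[OF g(2), OF st] approximates_mono[OF g(4), OF st]
    show "?g p (prod_encode (list_encode t, x)) = Suc v" by auto
  next
    fix p y x
    show "\<forall>\<^sub>F n in sequentially. ?g p (prod_encode (list_encode (map y [0..<n]), x)) =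
        Suc (prod_encode (f1 (join p y) x, f2 (join p y) x))"
      using approximates_lim[OF g(2), of p y x] approximates_lim[OF g(4), of p y x]
      by eventually_elim simp
  qed
  moreover have "pr ?g" by (intro pr_intros g)
  ultimately show ?case by blast
next
  case (pr_comp f1 f2)
  then obtain g1 g2 where g: "pr g1" "approximates g1 f1" "pr g2" "approximates g2 f2" by blast
  let ?g = "\<lambda>p z. if g2 p z = 0 then 0 else g1 p (prod_encode (pfst z, g2 p z - 1))"
  have "approximates ?g (\<lambda>p x. f1 p (f2 p x))"
    unfolding approximates_def
  proof (intro conjI allI impI, elim conjE)
    fix p s t x v
    assume st: "prefix s t" and v: "?g p (prod_encode (list_encode s, x)) = Suc v"
    then obtain v2 where "g2 p (prod_encode (list_encode s, x)) = Suc v2"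
      by (metis not0_implies_Suc nat.distinct(1))
    with v approximates_mono[OF g(2), OF st] approximates_mono[OF g(4), OF st]
    show "?g p (prod_encode (list_encode t, x)) = Suc v" by auto
  next
    fix p y x
    show "\<forall>\<^sub>F n in sequentially. ?g p (prod_encode (list_encode (map y [0..<n]), x)) =
        Suc (f1 (join p y) (f2 (join p y) x))"
      using approximates_lim[OF g(2), of p y "f2 (join p y) x"] approximates_lim[OF g(4), of p y x]
      by eventually_elim simp
  qed
  moreover have "pr ?g" by (intro pr_intros pr.pr_comp[OF g(1)] g)
  ultimately show ?case by blast
next
  case (pr_prec f1 f2)
  then obtain g1 g2 where g: "pr g1" "approximates g1 f1" "pr g2" "approximates g2 f2" by blast
  \<comment> \<open>\<open>y = 0\<close> says that an earlier stage of the recursion has failed;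
    otherwise \<open>y - 1\<close> is its value.\<close>
  let ?h = "\<lambda>p c a. rec_nat (g1 p (prod_encode (c, a)))
    (\<lambda>n y. if y = 0 then 0 else g2 p (prod_encode (c, prod_encode (a, prod_encode (n, y - 1)))))"
  let ?f = "\<lambda>p a. rec_nat (f1 p a) (\<lambda>n y. f2 p (prod_encode (a, prod_encode (n, y))))"
  let ?g = "\<lambda>p z. ?h p (pfst z) (pfst (psnd z)) (psnd (psnd z))"
  have "approximates ?g (\<lambda>p x. ?f p (pfst x) (psnd x))"
    unfolding approximates_def
  proof (intro conjI allI impI, elim conjE)
    fix p s t x v
    assume st: "prefix s t" and v: "?g p (prod_encode (list_encode s, x)) = Suc v"
    have "?h p (list_encode s) a n = Suc v \<Longrightarrow> ?h p (list_encode t) a n = Suc v" for a n v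
    proof (induction n arbitrary: v)
      case 0
      then show ?case using approximates_mono[OF g(2), OF st] by simp
    next
      case (Suc n)
      then obtain u where "?h p (list_encode s) a n = Suc u"
        by (cases "?h p (list_encode s) a n") auto
      with Suc.IH[OF this] Suc.prems show ?case using approximates_mono[OF g(4), OF st] by simp
    qed
    with v show "?g p (prod_encode (list_encode t, x)) = Suc v" by (simp cong: if_cong)
  next
    fix p y x
    have "\<forall>\<^sub>F n in sequentially. ?h p (list_encode (map y [0..<n])) a m = Suc (?f (join p y) a m)" for a m
    proof (induction m)
      case 0
      then show ?case using approximates_lim[OF g(2)] by simp
    next
      case (Suc m)
      with approximates_lim[OF g(4), of p y "prod_encode (a, prod_encode (m, ?f (join p y) a m))"]
      show ?case by eventually_elim simp
    qed
    then show "\<forall>\<^sub>F n in sequentially. ?g p (prod_encode (list_encode (map y [0..<n]), x)) =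
        Suc (?f (join p y) (pfst x) (psnd x))"
      by (simp cong: if_cong)
  qed
  moreover have "pr ?g"
    by (intro pr_rec pr_intros pr_comp[OF g(1)] pr_comp[OF g(3)])
  ultimately show ?case by blast
qed

lemma tree_rep_char:
  assumes "is_tree T" "\<And>s. p (list_encode s) = of_bool (s \<in> T)"
  shows "tree_rep p = Some T"
proof -
  have "p n = of_bool (list_decode n \<in> T)" for n
    using assms(2)[of "list_decode n"] by simp
  with assms show ?thesis
    by (auto simp: tree_rep_def char_rep_def cantor_rep_def Let_def)
qed

lemma tree_repD:
  assumes "tree_rep p = Some T"
  shows "is_tree T" "p (list_encode s) = of_bool (s \<in> T)"
proof -
  from assms have r: "range p \<subseteq> {0, 1}" and T: "T = {s. p (list_encode s) = 1}" "is_tree T"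
    by (auto simp: tree_rep_def char_rep_def cantor_rep_def Let_def split: if_splits)
  show "is_tree T" by (rule T(2))
  from r have "p (list_encode s) \<in> {0, 1}" by blast
  then show "p (list_encode s) = of_bool (s \<in> T)" by (auto simp: T(1))
qed

text \<open>A node is discarded once its own entries suffice to refute \<open>Q\<close> at some n
  below its length. A refutation persists under extension, so this gives a tree, and along a path
  every refutation is found eventually. The parameter x yields a whole family of trees at
  once.\<close>

theorem ex_tree_functional:
  assumes "prd Q"
  obtains t T where "pr t"
    "\<And>p x. tree_rep (\<lambda>k. t p (prod_encode (x, k))) = Some (T p x)"
    "\<And>p x. paths (T p x) = {y. \<forall>n. Q (join p y) (prod_encode (x, n))}"
proof -
  have "pr (\<lambda>p x. of_bool (\<not> Q p x))" by (intro pr_intros assms)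
  from ex_approximates[OF this] obtain g where
    g: "pr g" "approximates g (\<lambda>p x. of_bool (\<not> Q p x))" by blast
  \<comment> \<open>As g simulates the negation of \<open>Q\<close>, the value 0 means undecided and
    1 means that \<open>Q\<close> holds; only larger values refute.\<close>
  let ?t = "\<lambda>p z. of_bool (\<forall>n<clen (psnd z). g p (prod_encode (psnd z, prod_encode (pfst z, n))) \<le> 1)"
  define T where
    "T p x = {s. \<forall>n<length s. g p (prod_encode (list_encode s, prod_encode (x, n))) \<le> 1}" for p x
  show thesis
  proof (rule that)
    show "pr ?t" by (intro pr_intros pr_comp[OF g(1)])
    fix p x
    have "is_tree (T p x)"
      unfolding is_tree_def
    proof (intro allI impI, elim conjE)
      fix s t assume t: "t \<in> T p x" and st: "prefix s t"
      have "g p (prod_encode (list_encode s, prod_encode (x, n))) \<le> 1" if "n < length s" for n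
      proof (cases "g p (prod_encode (list_encode s, prod_encode (x, n)))")
        case (Suc v)
        from t that prefix_length_le[OF st]
        have "g p (prod_encode (list_encode t, prod_encode (x, n))) \<le> 1"
          by (simp add: T_def)
        with approximates_mono[OF g(2), OF st Suc] Suc show ?thesis by simp
      qed simp
      then show "s \<in> T p x" by (simp add: T_def)
    qed
    then show "tree_rep (\<lambda>k. ?t p (prod_encode (x, k))) = Some (T p x)"
      by (rule tree_rep_char) (simp add: T_def)
    have "y \<in> paths (T p x) \<longleftrightarrow> (\<forall>n. Q (join p y) (prod_encode (x, n)))" for y
    proof
      assume y: "y \<in> paths (T p x)"
      show "\<forall>n. Q (join p y) (prod_encode (x, n))"
      proof
        fix n
        have "\<forall>\<^sub>F m in sequentially. Q (join p y) (prod_encode (x, n))"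
          using approximates_lim[OF g(2), of p y "prod_encode (x, n)"] eventually_gt_at_top[of n]
        proof eventually_elim
          case (elim m)
          from y have "map y [0..<m] \<in> T p x" by (simp add: paths_def)
          with elim show ?case by (auto simp: T_def)
        qed
        then show "Q (join p y) (prod_encode (x, n))" by simp
      qed
    next
      assume y: "\<forall>n. Q (join p y) (prod_encode (x, n))"
      have "g p (prod_encode (list_encode (map y [0..<m]), prod_encode (x, n))) \<le> 1" for m n
        using approximates_sound[OF g(2), of p y m "prod_encode (x, n)"] y
        by (cases "g p (prod_encode (list_encode (map y [0..<m]), prod_encode (x, n)))") auto
      then show "y \<in> paths (T p x)" by (simp add: paths_def T_def)
    qed
    then show "paths (T p x) = {y. \<forall>n. Q (join p y) (prod_encode (x, n))}" by blast
  qed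
qed

section \<open>Comparison of trees\<close>

definition lift :: "baire \<Rightarrow> nat list \<Rightarrow> nat list" where
  "lift y s = map (\<lambda>i. y (list_encode (take (Suc i) s))) [0..<length s]"

text \<open>
  \<open>y\<close> codes a map between the trees that preserves lengths and prefixes: it gives the last entry of
  the image of each nonempty sequence. For well-founded trees such a map exists iff the rank of \<open>S\<close>
  is at most the rank of \<open>T\<close>.
\<close>

definition morph :: "baire \<Rightarrow> nat list set \<Rightarrow> nat list set \<Rightarrow> bool" where
  "morph y S T \<longleftrightarrow> (\<forall>s\<in>S. lift y s \<in> T)"

lemma length_lift [simp]: "length (lift y s) = length s"
  by (simp add: lift_def)

lemma lift_Nil [simp]: "lift y [] = []"
  by (simp add: lift_def)

lemma lift_snoc: "lift y (s @ [a]) = lift y s @ [y (list_encode (s @ [a]))]"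
  by (simp add: lift_def)

lemma is_tree_prefix: "is_tree T \<Longrightarrow> t \<in> T \<Longrightarrow> prefix s t \<Longrightarrow> s \<in> T"
  by (auto simp: is_tree_def)

lemma take_map_upt: "m \<le> n \<Longrightarrow> take m (map x [0..<n]) = map x [0..<m]"
  by (simp add: take_map)

text \<open>The images of the initial segments of a path extend one another, so their last entries
  form a path.\<close>

lemma morph_paths:
  assumes "morph y S T" "paths S \<noteq> {}"
  shows "paths T \<noteq> {}"
proof -
  obtain x where x: "x \<in> paths S" using assms(2) by blast
  let ?z = "\<lambda>i. y (list_encode (map x [0..<Suc i]))"
  have "lift y (map x [0..<n]) = map ?z [0..<n]" for n
    by (auto simp: lift_def take_map_upt simp del: upt_Suc)
  with assms(1) x have "?z \<in> paths T"
    by (auto simp: paths_def morph_def simp del: upt_Suc) metis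
  then show ?thesis by blast
qed

text \<open>Every node is sent to the node of the same length on a fixed path of T.\<close>

lemma morph_to_path:
  assumes "paths T \<noteq> {}"
  shows "\<exists>y. morph y S T"
proof -
  obtain x where x: "x \<in> paths T" using assms by blast
  let ?y = "\<lambda>c. x (length (list_decode c) - 1)"
  have "lift ?y s = map x [0..<length s]" for s
    by (auto simp: lift_def)
  then have "morph ?y S T" using x by (simp add: morph_def paths_def)
  then show ?thesis by blast
qed

text \<open>The simulation order, which compares the rank of the node s in S with that of t in T
  without ordinals. Being a greatest fixed point, it also holds whenever t lies on an infinite path
  of T.\<close>

coinductive tle :: "nat list set \<Rightarrow> nat list set \<Rightarrow> nat list \<Rightarrow> nat list \<Rightarrow> bool" for S T where
  "(\<And>a. s @ [a] \<in> S \<Longrightarrow> \<exists>b. t @ [b] \<in> T \<and> tle S T (s @ [a]) (t @ [b])) \<Longrightarrow> tle S T s t"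

text \<open>A failure yields a child of s that is below no child of t; this one child answers all
  children of t, so coinduction applies.\<close>

lemma tle_total: "\<not> tle S T s t \<Longrightarrow> tle T S t s"
proof (coinduction arbitrary: s t)
  case (tle s t)
  then show ?case by (metis tle.intros)
qed

lemma morph_of_tle:
  assumes "is_tree S" "tle S T [] []" "[] \<in> T"
  shows "\<exists>y. morph y S T"
proof -
  define nx where "nx s t a = (SOME b. t @ [b] \<in> T \<and> tle S T (s @ [a]) (t @ [b]))" for s t a
  \<comment> \<open>\<open>rec_list\<close> takes off the head, whereas a node grows at its end,
    hence the reversal.\<close>
  define r where "r = rec_list [] (\<lambda>a s t. t @ [nx (rev s) t a])"
  define y where "y c = last (r (rev (list_decode c)))" for c
  have lift: "lift y s = r (rev s)" for s
    by (induction s rule: rev_induct) (auto simp: lift_snoc y_def r_def)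
  have "s \<in> S \<Longrightarrow> lift y s \<in> T \<and> tle S T s (lift y s)" for s
  proof (induction s rule: rev_induct)
    case Nil
    show ?case using assms(2,3) by simp
  next
    case (snoc a s)
    then have "s \<in> S" using is_tree_prefix[OF assms(1)] by (meson prefixI)
    with snoc.IH have "tle S T s (lift y s)" by simp
    then have "\<exists>b. lift y s @ [b] \<in> T \<and> tle S T (s @ [a]) (lift y s @ [b])"
      using snoc.prems by (auto elim: tle.cases)
    from someI_ex[OF this] show ?case
      by (simp add: lift r_def nx_def)
  qed
  then show ?thesis by (auto simp: morph_def)
qed

lemma morph_total:
  assumes "is_tree S" "is_tree T"
  shows "(\<exists>y. morph y S T) \<or> (\<exists>y. morph y T S)"
proof (cases "[] \<in> S \<and> [] \<in> T")
  case True
  then show ?thesis using morph_of_tle assms tle_total by blast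
next
  case False
  then have "S = {} \<or> T = {}" using assms unfolding is_tree_def by (metis Nil_prefix all_not_in_conv)
  then show ?thesis by (auto simp: morph_def)
qed

lemma ex_chain_limit:
  assumes "\<And>n. length (f n) = n" "\<And>n. prefix (f n) (f (Suc n))"
  shows "\<exists>x. \<forall>n. map x [0..<n] = f n"
proof -
  define x where "x n = last (f (Suc n))" for n
  have "map x [0..<n] = f n" for n
  proof (induction n)
    case 0
    show ?case using assms(1)[of 0] by simp
  next
    case (Suc n)
    obtain u where u: "f (Suc n) = f n @ u" using assms(2)[of n] by (auto simp: prefix_def)
    then have "length u = 1" using assms(1)[of n] assms(1)[of "Suc n"] by simp
    then obtain b where "u = [b]" by (auto simp: length_Suc_conv)
    with u Suc show ?case by (simp add: x_def)
  qed
  then show ?thesis by blast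
qed

text \<open>Ranks admit no infinite descent, except by starting from a tree with a path. Nodes
  \<open>s i\<close> of all trees are extended simultaneously: a child of \<open>s i\<close> is
  taken that is below no child of \<open>s (Suc i)\<close>, whichever child is taken there. The
  nodes in tree 0 form the path.\<close>

lemma morph_wf:
  assumes T: "\<And>i. is_tree (T i)" and "\<And>i y. \<not> morph y (T i) (T (Suc i))"
  shows "paths (T 0) \<noteq> {}"
proof -
  have "T i \<noteq> {}" for i using assms(2)[of _ i] by (auto simp: morph_def)
  then have nil: "[] \<in> T i" for i
    using T[of i] unfolding is_tree_def by (metis Nil_prefix all_not_in_conv)
  define P where
    "P n s \<longleftrightarrow> (\<forall>i. length (s i) = n \<and> s i \<in> T i \<and> \<not> tle (T i) (T (Suc i)) (s i) (s (Suc i)))" for n s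
  have "\<exists>f. \<forall>n. P n (f n) \<and> (\<forall>i. prefix (f n i) (f (Suc n) i))"
  proof (rule dependent_nat_choice)
    show "\<exists>s. P 0 s"
      using morph_of_tle[OF T] nil assms(2) by (intro exI[of _ "\<lambda>_. []"]) (simp add: P_def, blast)
  next
    fix s n assume "P n s"
    then have "\<forall>i. \<exists>a. s i @ [a] \<in> T i \<and> (\<forall>b. s (Suc i) @ [b] \<in> T (Suc i) \<longrightarrow>
        \<not> tle (T i) (T (Suc i)) (s i @ [a]) (s (Suc i) @ [b]))"
      unfolding P_def by (metis tle.intros)
    then obtain a where "\<And>i. s i @ [a i] \<in> T i \<and> (\<forall>b. s (Suc i) @ [b] \<in> T (Suc i) \<longrightarrow>
        \<not> tle (T i) (T (Suc i)) (s i @ [a i]) (s (Suc i) @ [b]))"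
      by metis
    with \<open>P n s\<close> have "P (Suc n) (\<lambda>i. s i @ [a i])" by (auto simp: P_def)
    then show "\<exists>s'. P (Suc n) s' \<and> (\<forall>i. prefix (s i) (s' i))" by (auto intro: exI[of _ "\<lambda>i. s i @ [a i]"])
  qed
  then obtain f where f: "\<And>n. P n (f n)" "\<And>n i. prefix (f n i) (f (Suc n) i)" by blast
  have "\<exists>x. \<forall>n. map x [0..<n] = f n 0"
    using f by (intro ex_chain_limit) (auto simp: P_def)
  with f(1) show ?thesis by (auto simp: paths_def P_def) metis
qed

section \<open>Weihrauch reducibility\<close>

lemma weihrauch_leI:
  assumes "computable H" "computable K"
    and "\<And>p x. in_rep f p = Some x \<Longrightarrow> val f x \<noteq> {} \<Longrightarrow>
      \<exists>h u. H p = Some h \<and> in_rep g h = Some u \<and> val g u \<noteq> {} \<and>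
        (\<forall>q v. out_rep g q = Some v \<and> v \<in> val g u \<longrightarrow>
           (\<exists>k y. K (join p q) = Some k \<and> out_rep f k = Some y \<and> y \<in> val f x))"
  shows "f \<le>\<^sub>W g"
proof -
  have "realizes (\<lambda>p. Option.bind (H p) (\<lambda>h. Option.bind (G h) (\<lambda>q. K (join p q)))) f"
    if G: "realizes G g" for G
    unfolding realizes_def
  proof (intro allI impI, elim conjE)
    fix p x assume "in_rep f p = Some x" "val f x \<noteq> {}"
    from assms(3)[OF this] obtain h u where h: "H p = Some h" "in_rep g h = Some u" "val g u \<noteq> {}"
      and K: "\<And>q v. out_rep g q = Some v \<Longrightarrow> v \<in> val g u \<Longrightarrow>
         \<exists>k y. K (join p q) = Some k \<and> out_rep f k = Some y \<and> y \<in> val f x" by blast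
    obtain q v where "G h = Some q" "out_rep g q = Some v" "v \<in> val g u"
      using G h(2,3) unfolding realizes_def by blast
    with K[of q v] h(1) show "\<exists>k y. Option.bind (H p) (\<lambda>h. Option.bind (G h) (\<lambda>q. K (join p q))) = Some k
        \<and> out_rep f k = Some y \<and> y \<in> val f x" by auto
  qed
  with assms(1,2) show ?thesis unfolding weihrauch_le_def by blast
qed

text \<open>Turns the quantifier over realizers into one over single answers: a fixed realizer
  \<open>G0\<close> is altered at the one name h so as to return the answer q. By
  \<open>named\<close> a realizer exists at all.\<close>

lemma weihrauch_leE:
  assumes "f \<le>\<^sub>W g"
    and named: "\<And>h u. in_rep g h = Some u \<Longrightarrow> val g u \<noteq> {} \<Longrightarrow> \<exists>q v. out_rep g q = Some v \<and> v \<in> val g u"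
  obtains H K where "computable H" "computable K"
    and "\<And>p x. in_rep f p = Some x \<Longrightarrow> val f x \<noteq> {} \<Longrightarrow>
      \<exists>h u. H p = Some h \<and> in_rep g h = Some u \<and> val g u \<noteq> {} \<and>
        (\<forall>q v. out_rep g q = Some v \<and> v \<in> val g u \<longrightarrow>
           (\<exists>k y. K (join p q) = Some k \<and> out_rep f k = Some y \<and> y \<in> val f x))"
proof -
  obtain H K where HK: "computable H" "computable K"
    and r: "\<And>G. realizes G g \<Longrightarrow>
      realizes (\<lambda>p. Option.bind (H p) (\<lambda>h. Option.bind (G h) (\<lambda>q. K (join p q)))) f"
    using assms(1) unfolding weihrauch_le_def by blast
  define ok where "ok h q \<longleftrightarrow> (\<exists>u v. in_rep g h = Some u \<and> out_rep g q = Some v \<and> v \<in> val g u)" for h q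
  define G0 where "G0 h = (if \<exists>q. ok h q then Some (SOME q. ok h q) else None)" for h
  have G0: "ok h q" if "G0 h = Some q" for h q
    using that someI_ex[of "ok h"] by (auto simp: G0_def split: if_splits)
  have real: "realizes G g" if "\<And>h q. ok h q \<Longrightarrow> \<exists>q'. G h = Some q' \<and> ok h q'" for G
    unfolding realizes_def
  proof (intro allI impI, elim conjE)
    fix h u assume h: "in_rep g h = Some u" "val g u \<noteq> {}"
    then have "\<exists>q. ok h q" unfolding ok_def using named[of h u] by simp
    then obtain q where "ok h q" ..
    from that[OF this] obtain q' where "G h = Some q'" "ok h q'" by (elim exE conjE)
    with h show "\<exists>q y. G h = Some q \<and> out_rep g q = Some y \<and> y \<in> val g u"
      by (auto simp: ok_def)
  qed
  show thesis
  proof (rule that[OF HK])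
    fix p x assume px: "in_rep f p = Some x" "val f x \<noteq> {}"
    have "realizes G0 g"
      by (rule real) (metis G0 G0_def)
    from r[OF this] px obtain k where "Option.bind (H p) (\<lambda>h. Option.bind (G0 h) (\<lambda>q. K (join p q))) = Some k"
      unfolding realizes_def by blast
    then obtain h q where h: "H p = Some h" "G0 h = Some q"
      by (auto simp: bind_eq_Some_conv)
    with G0 obtain u where u: "in_rep g h = Some u" "val g u \<noteq> {}" unfolding ok_def by blast
    have "\<exists>k y. K (join p q) = Some k \<and> out_rep f k = Some y \<and> y \<in> val f x"
      if q: "out_rep g q = Some v" "v \<in> val g u" for q v
    proof -
      have "realizes (G0(h := Some q)) g"
      proof (rule real)
        fix h' q' assume "ok h' q'"
        moreover from q u have "ok h q" unfolding ok_def by blast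
        ultimately show "\<exists>q''. (G0(h := Some q)) h' = Some q'' \<and> ok h' q''"
          using someI_ex[of "ok h'"] by (auto simp: G0_def)
      qed
      from r[OF this] px obtain k y where
        "Option.bind (H p) (\<lambda>h'. Option.bind ((G0(h := Some q)) h') (\<lambda>q. K (join p q))) = Some k"
        "out_rep f k = Some y" "y \<in> val f x"
        unfolding realizes_def by blast
      with h(1) show ?thesis by auto
    qed
    with h(1) u show "\<exists>h u. H p = Some h \<and> in_rep g h = Some u \<and> val g u \<noteq> {} \<and>
        (\<forall>q v. out_rep g q = Some v \<and> v \<in> val g u \<longrightarrow>
           (\<exists>k y. K (join p q) = Some k \<and> out_rep f k = Some y \<and> y \<in> val f x))" by blast
  qed
qed

text \<open>The program computes an entry of either half before parity selects one of them; both
  computations halt because both functions are defined at r.\<close>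

lemma computable_join:
  assumes "computable F" "computable G"
  shows "computable (\<lambda>r. Option.bind (F r) (\<lambda>a. Option.bind (G r) (\<lambda>b. Some (join a b))))"
proof -
  obtain c d where c: "\<And>p q n. F p = Some q \<Longrightarrow> evals p c n (q n)"
    and d: "\<And>p q n. G p = Some q \<Longrightarrow> evals p d n (q n)"
    using assms unfolding computable_def by metis
  have "pr (\<lambda>p x. if pfst x mod 2 = 0 then pfst (psnd x) else psnd (psnd x))"
    by (intro pr_intros)
  from pr_program[OF this] obtain e where
    e: "\<And>p x. evals p e x (if pfst x mod 2 = 0 then pfst (psnd x) else psnd (psnd x))" by blast
  have "pr (\<lambda>p x. x div 2)" "pr (\<lambda>p x. x)" by (intro pr_intros)+
  then obtain h i where h: "\<And>p x. evals p h x (x div 2)" and i: "\<And>p x. evals p i x x"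
    using pr_program by meson
  let ?c = "Comp e (Tup i (Tup (Comp c h) (Comp d h)))"
  have "evals p ?c n (join a b n)" if "F p = Some a" "G p = Some b" for p a b n
  proof -
    have "evals p (Tup i (Tup (Comp c h) (Comp d h))) n
        (prod_encode (n, prod_encode (a (n div 2), b (n div 2))))"
      by (intro evals_Tup i evals_Comp[OF h c[OF that(1)]] evals_Comp[OF h d[OF that(2)]])
    from evals_Comp[OF this e] show ?thesis
      by (simp add: join_def even_iff_mod_2_eq_zero cong: if_cong split del: if_split)
  qed
  then show ?thesis unfolding computable_def
    by (intro exI[of _ ?c]) (auto simp: bind_eq_Some_conv)
qed

lemma weihrauch_le_trans:
  assumes "f \<le>\<^sub>W g" "g \<le>\<^sub>W h"
  shows "f \<le>\<^sub>W h"
proof -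
  obtain H1 K1 where 1: "computable H1" "computable K1"
    "\<And>G. realizes G g \<Longrightarrow> realizes (\<lambda>p. Option.bind (H1 p) (\<lambda>h. Option.bind (G h) (\<lambda>q. K1 (join p q)))) f"
    using assms(1) unfolding weihrauch_le_def by blast
  obtain H2 K2 where 2: "computable H2" "computable K2"
    "\<And>G. realizes G h \<Longrightarrow> realizes (\<lambda>p. Option.bind (H2 p) (\<lambda>h. Option.bind (G h) (\<lambda>q. K2 (join p q)))) g"
    using assms(2) unfolding weihrauch_le_def by blast
  define l r :: "baire \<rightharpoonup> baire" where "l = (\<lambda>p. Some (\<lambda>n. p (2 * n)))" and "r = (\<lambda>p. Some (\<lambda>n. p (Suc (2 * n))))"
  have lr: "computable l" "computable r"
    unfolding l_def r_def by (intro computable_pr pr_intros)+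
  have join [simp]: "l (join p q) = Some p" "r (join p q) = Some q" for p q
    by (simp_all add: l_def r_def)
  define H where "H = (\<lambda>p. Option.bind (H1 p) H2)"
  \<comment> \<open>\<open>K2\<close> expects its own original input, so \<open>H1 p\<close> is
    computed again and joined with the answer q.\<close>
  define J where "J = (\<lambda>s. Option.bind (Option.bind (l s) H1) (\<lambda>a. Option.bind (r s) (\<lambda>b. Some (join a b))))"
  define K where "K = (\<lambda>s. Option.bind (Option.bind (l s) (\<lambda>a. Option.bind (Option.bind (J s) K2)
    (\<lambda>b. Some (join a b)))) K1)"
  have "computable H" "computable K"
    unfolding H_def K_def J_def by (intro computable_bind computable_join lr 1 2)+
  moreover have "realizes (\<lambda>p. Option.bind (H p) (\<lambda>h. Option.bind (G h) (\<lambda>q. K (join p q)))) f"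
    if "realizes G h" for G
  proof -
    have "Option.bind (H p) (\<lambda>h. Option.bind (G h) (\<lambda>q. K (join p q))) =
        Option.bind (H1 p) (\<lambda>h. Option.bind (Option.bind (H2 h) (\<lambda>h'. Option.bind (G h') (\<lambda>q. K2 (join h q))))
          (\<lambda>q. K1 (join p q)))" for p
      by (auto simp: H_def K_def J_def split: Option.bind_split)
    with 1(3)[OF 2(3)[OF that]] show ?thesis by simp
  qed
  ultimately show ?thesis unfolding weihrauch_le_def by blast
qed

section \<open>Reductions\<close>

text \<open>Lets the single quantifier of \<open>ex_tree_functional\<close> range over
  pairs.\<close>

lemma all_prod: "(\<forall>n. P (pfst n) (psnd n)) \<longleftrightarrow> (\<forall>i m. P i m)"
  by (metis fst_conv prod_encode_inverse snd_conv)

lemma column_column: "column (column p i) d = (\<lambda>k. p (prod_encode (i, prod_encode (d, k))))"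
  by (simp add: column_def fun_eq_iff)

lemma seq_rep_iff: "seq_rep \<delta> p = Some x \<longleftrightarrow> (\<forall>i. \<delta> (column p i) = Some (x i))"
proof (cases "\<forall>i. column p i \<in> dom \<delta>")
  case True
  then show ?thesis by (auto simp: seq_rep_def fun_eq_iff dom_def) (metis option.sel)
next
  case False
  then show ?thesis by (auto simp: seq_rep_def dom_def) (metis option.distinct(1))
qed

lemma sigma11_repI:
  "(\<And>d. tree_rep (column p (e d)) = Some (T d)) \<Longrightarrow> sigma11_rep e p = Some {d. paths (T d) \<noteq> {}}"
  by (simp add: sigma11_rep_def dom_def)

lemma pi11_repI:
  "(\<And>d. tree_rep (column p (e d)) = Some (T d)) \<Longrightarrow> pi11_rep e p = Some {d. paths (T d) = {}}"
  by (simp add: pi11_rep_def dom_def)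

lemma sigma11_repE:
  assumes "sigma11_rep e p = Some S"
  obtains T where "\<And>d. tree_rep (column p (e d)) = Some (T d)" "S = {d. paths (T d) \<noteq> {}}"
proof (rule that)
  show "tree_rep (column p (e d)) = Some (the (tree_rep (column p (e d))))" for d
  proof -
    have "column p (e d) \<in> dom tree_rep" using assms by (simp add: sigma11_rep_def split: if_splits)
    then show ?thesis by auto
  qed
  show "S = {d. paths (the (tree_rep (column p (e d)))) \<noteq> {}}"
    using assms by (simp add: sigma11_rep_def split: if_splits)
qed

lemma pi11_repE:
  assumes "pi11_rep e p = Some S"
  obtains T where "\<And>d. tree_rep (column p (e d)) = Some (T d)" "S = {d. paths (T d) = {}}"
proof (rule that)
  show "tree_rep (column p (e d)) = Some (the (tree_rep (column p (e d))))" for d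
  proof -
    have "column p (e d) \<in> dom tree_rep" using assms by (simp add: pi11_rep_def split: if_splits)
    then show ?thesis by auto
  qed
  show "S = {d. paths (the (tree_rep (column p (e d)))) = {}}"
    using assms by (simp add: pi11_rep_def split: if_splits)
qed

lemma seq_sigma11_repE:
  assumes "seq_rep (sigma11_rep e) p = Some S"
  obtains T where "\<And>i d. tree_rep (column (column p i) (e d)) = Some (T i d)"
    "\<And>i. S i = {d. paths (T i d) \<noteq> {}}"
proof -
  have "\<exists>T. (\<forall>d. tree_rep (column (column p i) (e d)) = Some (T d)) \<and> S i = {d. paths (T d) \<noteq> {}}" for i
  proof -
    from assms have "sigma11_rep e (column p i) = Some (S i)" by (simp add: seq_rep_iff)
    then show ?thesis by (rule sigma11_repE) blast
  qed
  with that show thesis by metis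
qed

lemma tree_rep_paths:
  "tree_rep p = Some T \<Longrightarrow> y \<in> paths T \<longleftrightarrow> (\<forall>m. p (list_encode (map y [0..<m])) = 1)"
  by (simp add: paths_def tree_repD(2))

lemma tree_rep_mem: "tree_rep p = Some T \<Longrightarrow> p (list_encode s) = 1 \<longleftrightarrow> s \<in> T"
  by (simp add: tree_repD(2))

lemma parallelization_simps [simp]:
  "in_rep (parallelization f) = seq_rep (in_rep f)"
  "out_rep (parallelization f) = seq_rep (out_rep f)"
  "val (parallelization f) x = {y. \<forall>i. y i \<in> val f (x i)}"
  by (simp_all add: parallelization_def)

lemma Sigma11_C_2_simps [simp]:
  "in_rep Sigma11_C_2 = sigma11_rep of_bool" "out_rep Sigma11_C_2 = bool_rep" "val Sigma11_C_2 S = S"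
  by (simp_all add: Sigma11_C_2_def)

lemma Sigma11_C_N_simps [simp]:
  "in_rep Sigma11_C_N = sigma11_rep id" "out_rep Sigma11_C_N = nat_rep" "val Sigma11_C_N S = S"
  by (simp_all add: Sigma11_C_N_def)

lemma bool_rep_iff: "bool_rep p = Some b \<longleftrightarrow> p 0 = of_bool b"
  by (auto simp: bool_rep_def)

lemma cantor_rep_iff: "cantor_rep p = Some x \<longleftrightarrow> p = (\<lambda>n. of_bool (x n))"
proof
  assume "cantor_rep p = Some x"
  then have "range p \<subseteq> {0, 1}" "x = (\<lambda>n. p n = 1)" by (auto simp: cantor_rep_def split: if_splits)
  moreover from this(1) have "p n \<in> {0, 1}" for n by blast
  ultimately show "p = (\<lambda>n. of_bool (x n))" by (auto simp: fun_eq_iff)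
qed (auto simp: cantor_rep_def)

text \<open>That a bit is wrong for instance i is a \<Pi>11 condition. The instances with
  \<open>False\<close> wrong are to be separated from those with \<open>True\<close> wrong; no
  instance has both bits wrong, and a separator gives a right bit everywhere.\<close>

lemma C_2_le_Sep: "parallelization Sigma11_C_2 \<le>\<^sub>W Pi11_Sep"
proof (rule weihrauch_leI)
  let ?H = "\<lambda>p m. p (prod_encode (pfst (m div 2), prod_encode (m mod 2, psnd (m div 2))))"
  let ?K = "\<lambda>r m. r (Suc (2 * pfst m))"
  show "computable (\<lambda>p. Some (?H p))" "computable (\<lambda>p. Some (?K p))"
    by (intro computable_pr pr_intros)+
  fix p S
  assume p: "in_rep (parallelization Sigma11_C_2) p = Some S" and S: "val (parallelization Sigma11_C_2) S \<noteq> {}"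
  from p obtain T where T: "\<And>i b. tree_rep (column (column p i) (of_bool b)) = Some (T i b)"
      "\<And>i. S i = {b. paths (T i b) \<noteq> {}}"
    by (auto elim: seq_sigma11_repE)
  let ?A = "{i. paths (T i False) = {}}" and ?B = "{i. paths (T i True) = {}}"
  have "pi11_rep id (\<lambda>n. ?H p (2 * n)) = Some ?A" "pi11_rep id (\<lambda>n. ?H p (2 * n + 1)) = Some ?B"
  proof -
    have "column (\<lambda>n. ?H p (2 * n)) i = column (column p i) (of_bool False)"
      "column (\<lambda>n. ?H p (2 * n + 1)) i = column (column p i) (of_bool True)" for i
      by (simp_all add: column_def fun_eq_iff)
    with T(1) show "pi11_rep id (\<lambda>n. ?H p (2 * n)) = Some ?A" "pi11_rep id (\<lambda>n. ?H p (2 * n + 1)) = Some ?B"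
      by (simp_all only: pi11_repI id_apply)
  qed
  then have "in_rep Pi11_Sep (?H p) = Some (?A, ?B)"
    by (simp add: Pi11_Sep_def prod_rep_def)
  moreover have "?A \<inter> ?B = {}"
  proof -
    obtain y where "\<And>i. y i \<in> S i" using S by auto
    then have "paths (T i (y i)) \<noteq> {}" for i by (simp add: T(2))
    then show ?thesis by (auto simp: disjoint_iff) (metis (full_types))
  qed
  moreover have "\<exists>k y. Some (?K (join p q)) = Some k \<and> out_rep (parallelization Sigma11_C_2) k = Some y
      \<and> y \<in> val (parallelization Sigma11_C_2) S"
    if q: "char_rep q = Some C" and C: "?A \<subseteq> C" "?B \<inter> C = {}" for q C
  proof -
    from q have "q = (\<lambda>n. of_bool (n \<in> C))"
      by (auto simp: char_rep_def cantor_rep_iff)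
    then have "out_rep (parallelization Sigma11_C_2) (?K (join p q)) = Some (\<lambda>i. i \<in> C)"
      by (simp add: seq_rep_iff bool_rep_iff column_def)
    moreover have "paths (T i (i \<in> C)) \<noteq> {}" for i
      using C by (cases "i \<in> C") auto
    then have "(\<lambda>i. i \<in> C) \<in> val (parallelization Sigma11_C_2) S"
      by (simp add: T(2))
    ultimately show ?thesis by blast
  qed
  ultimately show "\<exists>h u. Some (?H p) = Some h \<and> in_rep Pi11_Sep h = Some u \<and> val Pi11_Sep u \<noteq> {} \<and>
      (\<forall>q v. out_rep Pi11_Sep q = Some v \<and> v \<in> val Pi11_Sep u \<longrightarrow>
        (\<exists>k y. Some (?K (join p q)) = Some k \<and> out_rep (parallelization Sigma11_C_2) k = Some y
          \<and> y \<in> val (parallelization Sigma11_C_2) S))"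
    by (intro exI[of _ "?H p"] exI[of _ "(?A, ?B)"]) (auto simp: Pi11_Sep_def)
qed

text \<open>Columns other than 0 and 1 of the given name are arbitrary; they are overwritten by the
  empty tree, so that larger numbers become wrong answers.\<close>

lemma C_2_le_C_N: "parallelization Sigma11_C_2 \<le>\<^sub>W parallelization Sigma11_C_N"
proof (rule weihrauch_leI)
  let ?H = "\<lambda>p m. if pfst (psnd m) \<le> 1 then p m else 0"
  let ?K = "\<lambda>r m. r (Suc (2 * m))"
  show "computable (\<lambda>p. Some (?H p))" "computable (\<lambda>p. Some (?K p))"
    by (intro computable_pr pr_intros)+
  fix p S
  assume p: "in_rep (parallelization Sigma11_C_2) p = Some S" and S: "val (parallelization Sigma11_C_2) S \<noteq> {}"
  have zero: "tree_rep (\<lambda>_. 0) = Some {}"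
    by (rule tree_rep_char) (auto simp: is_tree_def)
  have "sigma11_rep id (column (?H p) i) = Some (of_bool ` S i)" for i
  proof -
    from p have "sigma11_rep of_bool (column p i) = Some (S i)" by (simp add: seq_rep_iff)
    then obtain T where T: "\<And>b. tree_rep (column (column p i) (of_bool b)) = Some (T b)"
        "S i = {b. paths (T b) \<noteq> {}}"
      using sigma11_repE by blast
    let ?T = "\<lambda>d :: nat. if d \<le> 1 then T (d = 1) else {}"
    have "tree_rep (column (column (?H p) i) (id d)) = Some (?T d)" for d
      using T(1)[of "d = 1"] by (cases "d = 0"; cases "d = 1") (auto simp: column_column zero)
    from sigma11_repI[of _ id, OF this] have "sigma11_rep id (column (?H p) i) = Some {d. paths (?T d) \<noteq> {}}"
      by simp
    also have "{d. paths (?T d) \<noteq> {}} = of_bool ` S i"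
    proof (intro equalityI subsetI)
      fix d :: nat assume "d \<in> {d. paths (?T d) \<noteq> {}}"
      then have "d \<le> 1" "(d = 1) \<in> S i" by (auto simp: T(2) paths_def split: if_splits)
      moreover from this(1) have "d = of_bool (d = 1)" by auto
      ultimately show "d \<in> of_bool ` S i" by blast
    next
      fix d :: nat assume "d \<in> of_bool ` S i"
      then obtain b where "b \<in> S i" "d = of_bool b" by blast
      then show "d \<in> {d. paths (?T d) \<noteq> {}}" by (cases b) (simp_all add: T(2))
    qed
    finally show ?thesis .
  qed
  then have "in_rep (parallelization Sigma11_C_N) (?H p) = Some (\<lambda>i. of_bool ` S i)"
    by (simp add: seq_rep_iff)
  moreover obtain y where y: "\<And>i. y i \<in> S i" using S by auto
  then have "(\<lambda>i. of_bool (y i)) \<in> val (parallelization Sigma11_C_N) (\<lambda>i. of_bool ` S i)"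
    by simp
  moreover have "\<exists>k y. Some (?K (join p q)) = Some k \<and> out_rep (parallelization Sigma11_C_2) k = Some y
      \<and> y \<in> val (parallelization Sigma11_C_2) S"
    if q: "seq_rep nat_rep q = Some v" and v: "\<And>i. v i \<in> of_bool ` S i" for q v
  proof -
    from v obtain b where "\<And>i. v i = of_bool (b i)" "\<And>i. b i \<in> S i" by (auto simp: image_iff) metis
    with q show ?thesis
      by (intro exI[of _ "?K (join p q)"] exI[of _ b])
        (auto simp: seq_rep_iff bool_rep_iff nat_rep_def column_def)
  qed
  ultimately show "\<exists>h u. Some (?H p) = Some h \<and> in_rep (parallelization Sigma11_C_N) h = Some u \<and>
      val (parallelization Sigma11_C_N) u \<noteq> {} \<and>
      (\<forall>q v. out_rep (parallelization Sigma11_C_N) q = Some v \<and> v \<in> val (parallelization Sigma11_C_N) u \<longrightarrow>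
        (\<exists>k y. Some (?K (join p q)) = Some k \<and> out_rep (parallelization Sigma11_C_2) k = Some y
          \<and> y \<in> val (parallelization Sigma11_C_2) S))"
    by (intro exI[of _ "?H p"] exI[of _ "\<lambda>i. of_bool ` S i"]) fastforce
qed

text \<open>A point of the closed set contains, for each i, a number at position (i, 0) and a path
  through the tree of this number at the positions (i, j + 1).\<close>

lemma C_N_le_C_NN: "parallelization Sigma11_C_N \<le>\<^sub>W C_NN"
proof -
  let ?K = "\<lambda>r m. r (Suc (2 * m))"
  let ?y = "\<lambda>r i j. r (Suc (2 * prod_encode (i, j)))"
  let ?Q = "\<lambda>r z. r (2 * prod_encode (pfst (psnd z), prod_encode (?y r (pfst (psnd z)) 0,
    list_encode (map (\<lambda>j. ?y r (pfst (psnd z)) (Suc j)) [0..<psnd (psnd z)])))) = 1"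
  have "prd ?Q" by (intro pr_intros)
  then obtain t V where t: "pr t"
    "\<And>p x. tree_rep (\<lambda>k. t p (prod_encode (x, k))) = Some (V p x)"
    "\<And>p x. paths (V p x) = {y. \<forall>n. ?Q (join p y) (prod_encode (x, n))}"
    by (rule ex_tree_functional) (rule that)
  let ?H = "\<lambda>p k. t p (prod_encode (0, k))"
  show ?thesis
  proof (rule weihrauch_leI)
    show "computable (\<lambda>p. Some (?H p))" "computable (\<lambda>p. Some (?K p))"
      by (intro computable_pr pr_intros pr_comp[OF t(1)])+
    fix p S
    assume p: "in_rep (parallelization Sigma11_C_N) p = Some S" and S: "val (parallelization Sigma11_C_N) S \<noteq> {}"
    from p obtain T where T: "\<And>i d. tree_rep (column (column p i) d) = Some (T i d)"
        "\<And>i. S i = {d. paths (T i d) \<noteq> {}}"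
      by (auto elim: seq_sigma11_repE)
    define V0 where "V0 = V p 0"
    have V: "paths V0 =
        {y. \<forall>i. (\<lambda>j. y (prod_encode (i, Suc j))) \<in> paths (T i (y (prod_encode (i, 0))))}"
      unfolding V0_def t(3) tree_rep_paths[OF T(1)] column_column all_prod[symmetric] by simp
    have "paths V0 \<noteq> {}"
    proof -
      from S obtain y where "\<And>i. y i \<in> S i" by auto
      then have "\<forall>i. \<exists>z. z \<in> paths (T i (y i))" by (auto simp: T(2))
      then obtain z where z: "\<And>i. z i \<in> paths (T i (y i))" by metis
      let ?z = "\<lambda>c. case psnd c of 0 \<Rightarrow> y (pfst c) | Suc j \<Rightarrow> z (pfst c) j"
      have "?z \<in> paths V0" using z by (simp add: V)
      then show ?thesis by blast
    qed
    moreover have "in_rep C_NN (?H p) = Some (paths V0)" by (simp add: C_NN_def closed_rep_def V0_def t(2))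
    moreover have "\<exists>k y. Some (?K (join p q)) = Some k \<and> out_rep (parallelization Sigma11_C_N) k = Some y
        \<and> y \<in> val (parallelization Sigma11_C_N) S" if q: "q \<in> paths V0" for q
      using q by (intro exI[of _ q] exI[of _ "\<lambda>i. q (prod_encode (i, 0))"])
        (auto simp: seq_rep_iff nat_rep_def column_def T(2) V)
    ultimately show "\<exists>h u. Some (?H p) = Some h \<and> in_rep C_NN h = Some u \<and> val C_NN u \<noteq> {} \<and>
      (\<forall>q v. out_rep C_NN q = Some v \<and> v \<in> val C_NN u \<longrightarrow>
        (\<exists>k y. Some (?K (join p q)) = Some k \<and> out_rep (parallelization Sigma11_C_N) k = Some y
          \<and> y \<in> val (parallelization Sigma11_C_N) S))"
      by (intro exI[of _ "?H p"] exI[of _ "paths V0"]) (simp add: C_NN_def baire_rep_def)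
  qed
qed

text \<open>Instance i = (n, k) asks whether the solution has value k at n. Bit b receives the tree
  of those solutions that agree with b; as there is just one solution, exactly one bit is
  right.\<close>

lemma UC_le_C_2: "UC_NN \<le>\<^sub>W parallelization Sigma11_C_2"
proof -
  \<comment> \<open>z codes (((n, k), b), m), where m is the level at which membership in the given
    tree is tested.\<close>
  let ?Q = "\<lambda>r z. r (2 * list_encode (map (\<lambda>j. r (Suc (2 * j))) [0..<psnd z])) = 1 \<and>
    (psnd (pfst z) = 1 \<longrightarrow> r (Suc (2 * pfst (pfst (pfst z)))) = psnd (pfst (pfst z))) \<and>
    (psnd (pfst z) = 0 \<longrightarrow> r (Suc (2 * pfst (pfst (pfst z)))) \<noteq> psnd (pfst (pfst z)))"
  have "prd ?Q" by (intro pr_intros)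
  then obtain t V where t: "pr t"
    "\<And>p x. tree_rep (\<lambda>k. t p (prod_encode (x, k))) = Some (V p x)"
    "\<And>p x. paths (V p x) = {y. \<forall>n. ?Q (join p y) (prod_encode (x, n))}"
    by (rule ex_tree_functional) (rule that)
  let ?H = "\<lambda>p m. t p (prod_encode (prod_encode (pfst m, pfst (psnd m)), psnd (psnd m)))"
  \<comment> \<open>Zero iff the answer is yes, so that the search for a zero finds the
    value.\<close>
  let ?g = "\<lambda>r z. 1 - r (Suc (2 * prod_encode (z, 0)))"
  let ?K = "\<lambda>r. if \<forall>x. \<exists>k. ?g r (prod_encode (x, k)) = 0
    then Some (\<lambda>x. LEAST k. ?g r (prod_encode (x, k)) = 0) else None"
  show ?thesis
  proof (rule weihrauch_leI)
    show "computable (\<lambda>p. Some (?H p))"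
      by (intro computable_pr pr_intros pr_comp[OF t(1)])
    show "computable ?K" by (intro computable_Mu pr_intros)
    fix p A
    assume p: "in_rep UC_NN p = Some A" and A: "val UC_NN A \<noteq> {}"
    then obtain T where T: "tree_rep p = Some T" "A = paths T"
      by (auto simp: UC_NN_def closed_rep_def)
    from A obtain x where x: "A = {x}" by (auto simp: UC_NN_def is_singleton_def split: if_splits)
    let ?V = "\<lambda>i b. V p (prod_encode (i, of_bool b))"
    have V: "tree_rep (column (column (?H p) i) (of_bool b)) = Some (?V i b)" for i b
      using t(2) by (simp add: column_column)
    have "paths (?V i b) = {y \<in> paths T. y (pfst i) = psnd i \<longleftrightarrow> b}" for i b
      unfolding t(3) tree_rep_paths[OF T(1)] by (cases b) auto
    then have ne: "paths (?V i b) \<noteq> {} \<longleftrightarrow> (b \<longleftrightarrow> x (pfst i) = psnd i)" for i b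
      using x T(2) by auto
    let ?S = "\<lambda>i. {x (pfst i) = psnd i}"
    have "in_rep (parallelization Sigma11_C_2) (?H p) = Some ?S"
      using sigma11_repI[of "column (?H p) _" of_bool, OF V] by (simp add: seq_rep_iff ne)
    moreover have "val (parallelization Sigma11_C_2) ?S \<noteq> {}" by auto
    moreover have "\<exists>k y. ?K (join p q) = Some k \<and> out_rep UC_NN k = Some y \<and> y \<in> val UC_NN A"
      if q: "seq_rep bool_rep q = Some v" and v: "\<And>i. v i \<in> ?S i" for q v
    proof -
      have "q (prod_encode (i, 0)) = of_bool (x (pfst i) = psnd i)" for i
        using q v[of i] by (simp add: seq_rep_iff bool_rep_iff column_def)
      then have g: "?g (join p q) (prod_encode (n, k)) = 0 \<longleftrightarrow> k = x n" for n k by auto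
      have "(LEAST k. k = x n) = x n" for n by (rule Least_equality) auto
      then have "?K (join p q) = Some x" unfolding g by simp
      then show ?thesis using x by (simp add: UC_NN_def baire_rep_def)
    qed
    ultimately show "\<exists>h u. Some (?H p) = Some h \<and> in_rep (parallelization Sigma11_C_2) h = Some u \<and>
      val (parallelization Sigma11_C_2) u \<noteq> {} \<and>
      (\<forall>q v. out_rep (parallelization Sigma11_C_2) q = Some v \<and> v \<in> val (parallelization Sigma11_C_2) u \<longrightarrow>
        (\<exists>k y. ?K (join p q) = Some k \<and> out_rep UC_NN k = Some y \<and> y \<in> val UC_NN A))"
      by (intro exI[of _ "?H p"] exI[of _ ?S]) fastforce
  qed
qed

section \<open>Separation by paths of a binary tree\<close>

definition bdrop :: "nat \<Rightarrow> nat \<Rightarrow> nat" where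
  "bdrop i c = rec_nat c (\<lambda>_ c. (c - 1) div 2) i"

lemma bdrop_bin_encode: "bdrop i (bin_encode \<sigma>) = bin_encode (drop i \<sigma>)"
proof (induction i)
  case (Suc i)
  have "(bin_encode \<tau> - 1) div 2 = bin_encode (tl \<tau>)" for \<tau> by (cases \<tau>) auto
  with Suc show ?case by (simp add: bdrop_def drop_Suc tl_drop)
qed (simp add: bdrop_def)

lemma pr_bdrop: "pr f \<Longrightarrow> pr g \<Longrightarrow> pr (\<lambda>p x. bdrop (f p x) (g p x))"
  unfolding bdrop_def by (intro pr_rec pr_intros)

text \<open>The digits 2 and 1 stand for \<open>True\<close> and \<open>False\<close>, so the first
  bit is read off from the parity of the code.\<close>

lemma bin_encode_drop:
  "bin_encode (drop i \<sigma>) = 0 \<longleftrightarrow> length \<sigma> \<le> i"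
  "i < length \<sigma> \<Longrightarrow> 1 - bin_encode (drop i \<sigma>) mod 2 = of_bool (\<sigma> ! i)"
proof -
  have "bin_encode \<tau> = 0 \<longleftrightarrow> \<tau> = []" for \<tau> by (cases \<tau>) auto
  then show "bin_encode (drop i \<sigma>) = 0 \<longleftrightarrow> length \<sigma> \<le> i" by simp
  assume "i < length \<sigma>"
  then have "drop i \<sigma> = \<sigma> ! i # drop (Suc i) \<sigma>" by (simp add: Cons_nth_drop_Suc)
  then show "1 - bin_encode (drop i \<sigma>) mod 2 = of_bool (\<sigma> ! i)" by (simp add: mod_Suc)
qed

lemma Sep_le_WKL: "Pi11_Sep \<le>\<^sub>W Sigma11_WKL"
proof -
  let ?c = "\<lambda>z. bdrop (pfst (psnd z)) (pfst z)"
  \<comment> \<open>z codes (s, (i, m)), with s the code of a string; \<open>?c z = 0\<close> means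
    that i is beyond its end. In the index the outer factor 2 selects p in the join, the inner one
    together with bit i the tree from the name of A or of B.\<close>
  let ?Q = "\<lambda>r z. ?c z = 0 \<or> r (2 * (2 * prod_encode (pfst (psnd z),
    list_encode (map (\<lambda>j. r (Suc (2 * prod_encode (pfst (psnd z), j)))) [0..<psnd (psnd z)])) +
    (1 - ?c z mod 2))) = 1"
  let ?K = "\<lambda>r m. r (Suc (2 * m))"
  have "prd ?Q" by (intro pr_intros pr_bdrop)
  then obtain t V where t: "pr t"
    "\<And>p x. tree_rep (\<lambda>k. t p (prod_encode (x, k))) = Some (V p x)"
    "\<And>p x. paths (V p x) = {y. \<forall>n. ?Q (join p y) (prod_encode (x, n))}"
    by (rule ex_tree_functional) (rule that)
  show ?thesis
  proof (rule weihrauch_leI)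
    show "computable (\<lambda>p. Some (t p))" "computable (\<lambda>p. Some (?K p))"
      by (intro computable_pr pr_intros t(1))+
    fix p AB
    assume p: "in_rep Pi11_Sep p = Some AB" and AB: "val Pi11_Sep AB \<noteq> {}"
    obtain A B where [simp]: "AB = (A, B)" by fastforce
    from AB have disj: "A \<inter> B = {}" by (auto simp: Pi11_Sep_def split: if_splits)
    from p have A: "pi11_rep id (\<lambda>n. p (2 * n)) = Some A" and B: "pi11_rep id (\<lambda>n. p (2 * n + 1)) = Some B"
      by (auto simp: Pi11_Sep_def prod_rep_def split: option.splits)
    from A obtain TA where TA: "\<And>i. tree_rep (column (\<lambda>n. p (2 * n)) (id i)) = Some (TA i)"
      "A = {i. paths (TA i) = {}}" by (rule pi11_repE) (rule that)
    from B obtain TB where TB: "\<And>i. tree_rep (column (\<lambda>n. p (2 * n + 1)) (id i)) = Some (TB i)"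
      "B = {i. paths (TB i) = {}}" by (rule pi11_repE) (rule that)
    let ?T = "\<lambda>i b. if b then TB i else TA i"
    have T: "y \<in> paths (?T i b) \<longleftrightarrow>
        (\<forall>m. p (2 * prod_encode (i, list_encode (map y [0..<m])) + of_bool b) = 1)" for y i b
      using tree_rep_paths[OF TA(1)] tree_rep_paths[OF TB(1)] by (auto simp: column_def)
    have V: "paths (V p (bin_encode \<sigma>)) = {y. \<forall>i<length \<sigma>. column y i \<in> paths (?T i (\<sigma> ! i))}" for \<sigma>
    proof -
      have "?Q (join p y) (prod_encode (bin_encode \<sigma>, n)) \<longleftrightarrow> (pfst n < length \<sigma> \<longrightarrow>
          p (2 * prod_encode (pfst n, list_encode (map (column y (pfst n)) [0..<psnd n])) +
            of_bool (\<sigma> ! pfst n)) = 1)" for y n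
      proof (cases "pfst n < length \<sigma>")
        case True
        then show ?thesis
          unfolding prod_encode_inverse fst_conv snd_conv bdrop_bin_encode bin_encode_drop(2)[OF True]
            bin_encode_drop(1) join_even join_odd
          by (simp add: column_def[abs_def])
      qed (simp add: bdrop_bin_encode bin_encode_drop(1))
      then have "y \<in> paths (V p (bin_encode \<sigma>)) \<longleftrightarrow> (\<forall>i m. i < length \<sigma> \<longrightarrow>
          p (2 * prod_encode (i, list_encode (map (column y i) [0..<m])) + of_bool (\<sigma> ! i)) = 1)" for y
        unfolding all_prod[symmetric] t(3) by simp
      then show ?thesis unfolding T by blast
    qed
    let ?W = "{\<sigma>. paths (V p (bin_encode \<sigma>)) \<noteq> {}}"
    have W: "\<sigma> \<in> ?W \<longleftrightarrow> (\<forall>i<length \<sigma>. paths (?T i (\<sigma> ! i)) \<noteq> {})" for \<sigma>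
    proof
      assume "\<forall>i<length \<sigma>. paths (?T i (\<sigma> ! i)) \<noteq> {}"
      then have "\<forall>i. \<exists>z. i < length \<sigma> \<longrightarrow> z \<in> paths (?T i (\<sigma> ! i))" by blast
      then obtain z where "\<And>i. i < length \<sigma> \<Longrightarrow> z i \<in> paths (?T i (\<sigma> ! i))" by metis
      moreover have "column (\<lambda>c. z (pfst c) (psnd c)) i = z i" for i
        by (simp add: column_def fun_eq_iff)
      ultimately have "(\<lambda>c. z (pfst c) (psnd c)) \<in> paths (V p (bin_encode \<sigma>))"
        by (simp only: V mem_Collect_eq) blast
      then show "\<sigma> \<in> ?W" by blast
    qed (auto simp: V)
    have sep: "x \<in> paths ?W \<longleftrightarrow> A \<subseteq> Collect x \<and> B \<inter> Collect x = {}" for x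
    proof -
      have "x \<in> paths ?W \<longleftrightarrow> (\<forall>i. paths (?T i (x i)) \<noteq> {})"
        unfolding paths_def[of ?W] mem_Collect_eq[of x] W
        by (simp del: upt_Suc) (metis lessI)
      also have "\<dots> \<longleftrightarrow> A \<subseteq> Collect x \<and> B \<inter> Collect x = {}"
        by (auto simp: TA(2) TB(2))
      finally show ?thesis .
    qed
    have "in_rep Sigma11_WKL (t p) = Some ?W"
      using sigma11_repI[of "t p" bin_encode "\<lambda>\<sigma>. V p (bin_encode \<sigma>)"] t(2)
      by (simp add: Sigma11_WKL_def column_def[abs_def])
    moreover have tree: "is_tree ?W"
      unfolding is_tree_def W by (auto simp: prefix_def nth_append)
    moreover have "(\<lambda>i. i \<in> A) \<in> paths ?W" using disj by (auto simp: sep)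
    moreover from this have "infinite ?W"
    proof -
      assume "(\<lambda>i. i \<in> A) \<in> paths ?W"
      then have "(\<lambda>n. map (\<lambda>i. i \<in> A) [0..<n]) ` UNIV \<subseteq> ?W" by (auto simp: paths_def)
      moreover have "inj (\<lambda>n. map (\<lambda>i. i \<in> A) [0..<n])"
        by (rule injI) (metis length_map length_upt diff_zero)
      ultimately show ?thesis using finite_subset range_inj_infinite by metis
    qed
    moreover have "\<exists>k y. Some (?K (join p q)) = Some k \<and> out_rep Pi11_Sep k = Some y \<and> y \<in> val Pi11_Sep AB"
      if "cantor_rep q = Some x" "x \<in> paths ?W" for q x
      using that disj by (simp add: Pi11_Sep_def char_rep_def sep)
    ultimately show "\<exists>h u. Some (t p) = Some h \<and> in_rep Sigma11_WKL h = Some u \<and> val Sigma11_WKL u \<noteq> {} \<and>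
        (\<forall>q v. out_rep Sigma11_WKL q = Some v \<and> v \<in> val Sigma11_WKL u \<longrightarrow>
          (\<exists>k y. Some (?K (join p q)) = Some k \<and> out_rep Pi11_Sep k = Some y \<and> y \<in> val Pi11_Sep AB))"
      by (intro exI[of _ "t p"] exI[of _ ?W]) (auto simp: Sigma11_WKL_def)
  qed
qed

lemma koenig:
  fixes W :: "bool list set"
  assumes "is_tree W" "infinite W"
  shows "paths W \<noteq> {}"
proof -
  define P where "P n s \<longleftrightarrow> length s = n \<and> infinite {t \<in> W. prefix s t}" for n s
  have "\<exists>f. \<forall>n. P n (f n) \<and> prefix (f n) (f (Suc n))"
  proof (rule dependent_nat_choice)
    show "\<exists>s. P 0 s" using assms(2) by (simp add: P_def)
  next
    fix s n assume P: "P n s"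
    have "{t \<in> W. prefix s t} \<subseteq> insert s (\<Union>b. {t \<in> W. prefix (s @ [b]) t})"
    proof
      fix t assume "t \<in> {t \<in> W. prefix s t}"
      then obtain u where "t \<in> W" "t = s @ u" by (auto simp: prefix_def)
      then show "t \<in> insert s (\<Union>b. {t \<in> W. prefix (s @ [b]) t})" by (cases u) auto
    qed
    with P have "infinite (insert s (\<Union>b. {t \<in> W. prefix (s @ [b]) t}))"
      using finite_subset unfolding P_def by blast
    then obtain b where "infinite {t \<in> W. prefix (s @ [b]) t}" by auto
    with P show "\<exists>s'. P (Suc n) s' \<and> prefix s s'" by (auto simp: P_def intro!: exI[of _ "s @ [b]"])
  qed
  then obtain f where f: "\<And>n. P n (f n)" "\<And>n. prefix (f n) (f (Suc n))" by blast
  have "f n \<in> W" for n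
  proof -
    have "{t \<in> W. prefix (f n) t} \<noteq> {}" using f(1)[of n] unfolding P_def by force
    then show ?thesis using assms(1) by (auto simp: is_tree_def)
  qed
  moreover obtain x where "\<And>n. map x [0..<n] = f n"
    using ex_chain_limit[of f] f by (auto simp: P_def)
  ultimately have "x \<in> paths W" by (simp add: paths_def)
  then show ?thesis by blast
qed

text \<open>For X with values 0 and 1 this is \<open>bin_encode\<close> of the first n values: the
  digit X i + 1 has weight 2 ^ i. Recursion on n fits \<open>pr_rec\<close>, whereas
  \<open>bin_encode\<close> recurses from the front.\<close>

definition benc :: "baire \<Rightarrow> nat \<Rightarrow> nat" where
  "benc X n = rec_nat 0 (\<lambda>i a. a + 2 ^ i * (X i + 1)) n"

lemma bin_encode_append: "bin_encode (\<sigma> @ \<tau>) = bin_encode \<sigma> + 2 ^ length \<sigma> * bin_encode \<tau>"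
  by (induction \<sigma>) (auto simp: algebra_simps)

lemma benc_bin_encode: "benc (\<lambda>i. of_bool (x i)) n = bin_encode (map x [0..<n])"
  by (induction n) (auto simp: benc_def bin_encode_append)

lemma pr_benc:
  assumes "pr (\<lambda>p z. X p (pfst z) (psnd z))" "pr k"
  shows "pr (\<lambda>p x. benc (X p x) (k p x))"
  unfolding benc_def
  using pr_comp[OF assms(1) pr_pair[OF pr_pfst pr_fst[OF pr_psnd]]]
  by (intro pr_rec pr_intros assms) simp

lemma pr_lift:
  assumes "pr (\<lambda>p z. y p (pfst z) (psnd z))" "pr k"
  shows "pr (\<lambda>p x. list_encode (lift (y p x) (list_decode (k p x))))"
proof -
  have "list_encode (lift Y (list_decode c)) =
      list_encode (map (\<lambda>i. Y (list_encode (map (cnth c) [0..<Suc i]))) [0..<clen c])" for Y c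
  proof -
    have "take (Suc i) s = map (cnth (list_encode s)) [0..<Suc i]" if "i < length s" for s i
      using that by (intro nth_equalityI) (auto simp: cnth_encode simp del: upt_Suc)
    from this[of _ "list_decode c"] show ?thesis
      unfolding lift_def clen_def
      by (intro arg_cong[of _ _ list_encode] map_cong refl) (simp del: upt_Suc)
  qed
  moreover have "pr (\<lambda>p x. list_encode (map (\<lambda>i. y p x (list_encode (map (cnth (k p x)) [0..<Suc i])))
      [0..<clen (k p x)]))"
    using pr_comp[OF assms(1) pr_pair[OF pr_pfst pr_codes[OF pr_cnth[OF pr_comp[OF assms(2)
      pr_comp[OF pr_pfst pr_pfst]] pr_psnd] pr_Suc[OF pr_psnd]]]]
    by (intro pr_intros assms) (simp del: upt_Suc)
  ultimately show ?thesis by simp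
qed

text \<open>
  The path is computed bit by bit, \<open>n\<close> bits with code \<open>w\<close> being known. The candidates \<open>d\<close> for the next
  bit are compared through the trees \<open>U\<close> of the paths that continue with \<open>d\<close>. Asking for a map from
  the tree of the other bit, rather than for a path, ensures that there is always a valid answer.
\<close>

lemma WKL_le_C_2: "Sigma11_WKL \<le>\<^sub>W parallelization Sigma11_C_2"
proof -
  let ?X = "\<lambda>r k j. r (Suc (2 * prod_encode (k, j)))"
  \<comment> \<open>z codes (((n, w), d), (k, m)). Column 0 of y is the path, required to begin with
    the n bits coded by w followed by d; column k + 1 witnesses that its first k bits form a
    node.\<close>
  let ?Q = "\<lambda>r z. ?X r 0 (pfst (psnd z)) \<le> 1 \<and>
    benc (?X r 0) (pfst (pfst (pfst z))) = psnd (pfst (pfst z)) \<and>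
    ?X r 0 (pfst (pfst (pfst z))) = psnd (pfst z) \<and>
    r (2 * prod_encode (benc (?X r 0) (pfst (psnd z)),
      list_encode (map (\<lambda>j. ?X r (Suc (pfst (psnd z))) j) [0..<psnd (psnd z)]))) = 1"
  have "prd ?Q" by (intro pr_intros pr_benc)
  then obtain t U where t: "pr t"
    "\<And>p x. tree_rep (\<lambda>k. t p (prod_encode (x, k))) = Some (U p x)"
    "\<And>p x. paths (U p x) = {y. \<forall>n. ?Q (join p y) (prod_encode (x, n))}"
    by (rule ex_tree_functional) (rule that)
  \<comment> \<open>z codes ((i, d), c): if node c lies in the tree of the other bit
    \<open>1 - d\<close>, its image under the map y has to lie in the tree of d. The even half of r
    is p.\<close>
  let ?R = "\<lambda>r z. t (\<lambda>k. r (2 * k)) (prod_encode (prod_encode (pfst (pfst z), 1 - psnd (pfst z)), psnd z)) = 1 \<longrightarrow>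
    t (\<lambda>k. r (2 * k)) (prod_encode (pfst z,
      list_encode (lift (\<lambda>k. r (Suc (2 * k))) (list_decode (psnd z))))) = 1"
  have "pr (\<lambda>r. t (\<lambda>k. r (2 * k)))" by (intro pr_oracle_subst[OF t(1)] pr_intros)
  note pr_t = pr_comp[OF this]
  have "prd ?R" by (intro pr_intros pr_t pr_lift)
  then obtain s V where s: "pr s"
    "\<And>p x. tree_rep (\<lambda>k. s p (prod_encode (x, k))) = Some (V p x)"
    "\<And>p x. paths (V p x) = {y. \<forall>n. ?R (join p y) (prod_encode (x, n))}"
    by (rule ex_tree_functional) (rule that)
  let ?H = "\<lambda>p m. s p (prod_encode (prod_encode (pfst m, pfst (psnd m)), psnd (psnd m)))"
  let ?a = "\<lambda>r n w. r (Suc (2 * prod_encode (prod_encode (n, w), 0)))"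
  let ?w = "\<lambda>r n. rec_nat 0 (\<lambda>n w. w + 2 ^ n * (?a r n w + 1)) n"
  let ?K = "\<lambda>r n. ?a r n (?w r n)"
  show ?thesis
  proof (rule weihrauch_leI)
    show "computable (\<lambda>p. Some (?H p))" "computable (\<lambda>p. Some (?K p))"
      by (intro computable_pr pr_intros pr_rec pr_comp[OF s(1)])+
    fix p W
    assume p: "in_rep Sigma11_WKL p = Some W" and "val Sigma11_WKL W \<noteq> {}"
    then have W: "is_tree W" "infinite W" by (auto simp: Sigma11_WKL_def split: if_splits)
    from p have "sigma11_rep bin_encode p = Some W" by (simp add: Sigma11_WKL_def)
    then obtain T where T: "\<And>\<sigma>. tree_rep (column p (bin_encode \<sigma>)) = Some (T \<sigma>)"
      "W = {\<sigma>. paths (T \<sigma>) \<noteq> {}}"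
      by (rule sigma11_repE) (rule that)
    have paths_W: "x \<in> paths W \<longleftrightarrow> (\<forall>k. paths (T (map x [0..<k])) \<noteq> {})" for x
      unfolding paths_def[of W] by (simp add: T(2))
    have V: "paths (V p (prod_encode (i, d))) =
        {y. morph y (U p (prod_encode (i, 1 - d))) (U p (prod_encode (i, d)))}" for i d
    proof -
      have t_mem: "t p (prod_encode (x, c)) = 1 \<longleftrightarrow> list_decode c \<in> U p x" for x c
        using tree_rep_mem[OF t(2), of p x "list_decode c"] by simp
      have "morph y S S' \<longleftrightarrow> (\<forall>n. list_decode n \<in> S \<longrightarrow> lift y (list_decode n) \<in> S')" for y S S'
        unfolding morph_def by (metis list_encode_inverse)
      moreover have "y \<in> paths (V p (prod_encode (i, d))) \<longleftrightarrow> (\<forall>n. list_decode n \<in> U p (prod_encode (i, 1 - d)) \<longrightarrow>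
          lift y (list_decode n) \<in> U p (prod_encode (i, d)))" for y
        by (simp only: s(3) mem_Collect_eq join_even join_odd prod_encode_inverse fst_conv snd_conv t_mem
            list_encode_inverse)
      ultimately show ?thesis by (simp only: set_eq_iff mem_Collect_eq simp_thms)
    qed
    have U: "paths (U p (prod_encode (prod_encode (n, w), d))) \<noteq> {} \<longleftrightarrow>
        (\<exists>x\<in>paths W. bin_encode (map x [0..<n]) = w \<and> of_bool (x n) = d)" for n w d
    proof
      assume "paths (U p (prod_encode (prod_encode (n, w), d))) \<noteq> {}"
      then obtain y where "\<forall>c. ?Q (join p y) (prod_encode (prod_encode (prod_encode (n, w), d), c))"
        unfolding t(3) by blast
      then have "?Q (join p y) (prod_encode (prod_encode (prod_encode (n, w), d), prod_encode (k, m)))" for k m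
        by blast
      then have y: "y (prod_encode (0, k)) \<le> 1" "benc (\<lambda>j. y (prod_encode (0, j))) n = w"
        "y (prod_encode (0, n)) = d"
        "p (prod_encode (benc (\<lambda>j. y (prod_encode (0, j))) k,
          list_encode (map (\<lambda>j. y (prod_encode (Suc k, j))) [0..<m]))) = 1" for k m
        by simp_all
      define x where "x k \<longleftrightarrow> y (prod_encode (0, k)) = 1" for k
      have x: "y (prod_encode (0, k)) = of_bool (x k)" for k
        using y(1)[of k] by (auto simp: x_def)
      have "(\<lambda>j. y (prod_encode (Suc k, j))) \<in> paths (T (map x [0..<k]))" for k
        using y(4)[of k] by (simp add: tree_rep_paths[OF T(1)] column_def x benc_bin_encode)
      then have "x \<in> paths W" unfolding paths_W by blast
      moreover have "bin_encode (map x [0..<n]) = w" "of_bool (x n) = d"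
        using y(2,3) unfolding x benc_bin_encode by simp_all
      ultimately show "\<exists>x\<in>paths W. bin_encode (map x [0..<n]) = w \<and> of_bool (x n) = d" by blast
    next
      assume "\<exists>x\<in>paths W. bin_encode (map x [0..<n]) = w \<and> of_bool (x n) = d"
      then obtain x where x: "x \<in> paths W" "bin_encode (map x [0..<n]) = w" "of_bool (x n) = d" by blast
      then have "\<forall>k. \<exists>z. z \<in> paths (T (map x [0..<k]))" unfolding paths_W by blast
      then obtain z where z: "\<And>k. z k \<in> paths (T (map x [0..<k]))" by metis
      define y where "y c = (case pfst c of 0 \<Rightarrow> of_bool (x (psnd c)) | Suc k \<Rightarrow> z k (psnd c))" for c
      have y: "y (prod_encode (0, j)) = of_bool (x j)" "y (prod_encode (Suc k, j)) = z k j" for k j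
        by (simp_all add: y_def)
      have "p (prod_encode (bin_encode (map x [0..<k]), list_encode (map (z k) [0..<m]))) = 1" for k m
        using z[of k] by (simp add: tree_rep_paths[OF T(1)] column_def)
      with x have "y \<in> paths (U p (prod_encode (prod_encode (n, w), d)))"
        by (simp add: t(3) y benc_bin_encode)
      then show "paths (U p (prod_encode (prod_encode (n, w), d))) \<noteq> {}" by blast
    qed
    let ?S = "\<lambda>i. {b. paths (V p (prod_encode (i, of_bool b))) \<noteq> {}}"
    have "tree_rep (column (column (?H p) i) d) = Some (V p (prod_encode (i, d)))" for i d
      using s(2) by (simp add: column_column)
    from sigma11_repI[of "column (?H p) _" of_bool, OF this]
    have "in_rep (parallelization Sigma11_C_2) (?H p) = Some ?S"
      by (simp add: seq_rep_iff)
    moreover have "?S i \<noteq> {}" for i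
    proof -
      have "is_tree (U p x)" for x using tree_repD(1)[OF t(2)] .
      from morph_total[OF this this, of "prod_encode (i, 0)" "prod_encode (i, 1)"]
      have "False \<in> ?S i \<or> True \<in> ?S i" by (auto simp: V)
      then show ?thesis by blast
    qed
    then have "\<forall>i. \<exists>b. b \<in> ?S i" by blast
    then obtain b where "\<forall>i. b i \<in> ?S i" by (rule choice[THEN exE])
    then have "b \<in> val (parallelization Sigma11_C_2) ?S" by simp
    then have "val (parallelization Sigma11_C_2) ?S \<noteq> {}" by blast
    moreover have "\<exists>k y. Some (?K (join p q)) = Some k \<and> out_rep Sigma11_WKL k = Some y \<and> y \<in> val Sigma11_WKL W"
      if q: "seq_rep bool_rep q = Some v" and v: "\<And>i. v i \<in> ?S i" for q v
    proof -
      have q': "q (prod_encode (i, 0)) = of_bool (v i)" for i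
        using q by (simp add: seq_rep_iff bool_rep_iff column_def)
      define w where "w n = rec_nat 0 (\<lambda>n w. w + 2 ^ n * (of_bool (v (prod_encode (n, w))) + 1)) n" for n
      define x where "x n = v (prod_encode (n, w n))" for n
      have K: "?K (join p q) = (\<lambda>n. of_bool (x n))"
        by (simp add: q' x_def w_def)
      have w: "w n = bin_encode (map x [0..<n])" for n
        unfolding benc_bin_encode[symmetric]
        by (induction n) (simp_all add: w_def benc_def x_def)
      have *: "\<exists>z\<in>paths W. map z [0..<n] = map x [0..<n]" for n
      proof (induction n)
        case 0
        show ?case using koenig[OF W] by auto
      next
        case (Suc n)
        then obtain z where z: "z \<in> paths W" "map z [0..<n] = map x [0..<n]" by blast
        let ?U = "\<lambda>b. U p (prod_encode (prod_encode (n, w n), of_bool b))"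
        have "x n \<in> ?S (prod_encode (n, w n))" using v by (simp add: x_def)
        then obtain y where y: "morph y (U p (prod_encode (prod_encode (n, w n), 1 - of_bool (x n)))) (?U (x n))"
          by (auto simp: V)
        have "paths (?U (z n)) \<noteq> {}" unfolding U w z(2)[symmetric] using z(1) by blast
        \<comment> \<open>If z continues with the chosen bit, this is immediate; if not, the map y
          carries the path from the tree of the other bit to that of the chosen one.\<close>
        then have "paths (?U (x n)) \<noteq> {}"
          using morph_paths[OF y] by (cases "x n"; cases "z n") auto
        then obtain z' where z': "z' \<in> paths W" "bin_encode (map z' [0..<n]) = bin_encode (map x [0..<n])"
            "z' n = x n"
          unfolding U w of_bool_eq_iff by blast
        then have "map z' [0..<n] = map x [0..<n]"
          using injD[OF bij_is_inj[OF bij_bin_encode]] by blast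
        with z' have "map z' [0..<Suc n] = map x [0..<Suc n]" by simp
        with z'(1) show ?case by blast
      qed
      have "map x [0..<n] \<in> W" for n
      proof -
        from * obtain z where "z \<in> paths W" "map z [0..<n] = map x [0..<n]" by blast
        moreover from this(1) have "map z [0..<n] \<in> W" by (simp add: paths_def)
        ultimately show ?thesis by metis
      qed
      then have "x \<in> paths W" by (simp add: paths_def[of W])
      with W show ?thesis unfolding K by (auto simp: Sigma11_WKL_def cantor_rep_iff)
    qed
    ultimately show "\<exists>h u. Some (?H p) = Some h \<and> in_rep (parallelization Sigma11_C_2) h = Some u \<and>
        val (parallelization Sigma11_C_2) u \<noteq> {} \<and>
        (\<forall>q v. out_rep (parallelization Sigma11_C_2) q = Some v \<and> v \<in> val (parallelization Sigma11_C_2) u \<longrightarrow>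
          (\<exists>k y. Some (?K (join p q)) = Some k \<and> out_rep Sigma11_WKL k = Some y \<and> y \<in> val Sigma11_WKL W))"
      by (intro exI[of _ "?H p"] exI[of _ ?S]) fastforce
  qed
qed

section \<open>Separations\<close>

lemma ex_causal_fixpoint:
  fixes F :: "baire \<Rightarrow> baire"
  assumes "\<And>p q n. agree n p q \<Longrightarrow> F p n = F q n"
  shows "\<exists>p. F p = p"
proof -
  have "adm_wf less_than F"
    using assms by (auto simp: adm_wf_def agree_def)
  from wfrec_fixpoint[OF wf_less_than this] show ?thesis by metis
qed

text \<open>The infinite paths of \<open>appr P p\<close> form the section at \<open>p\<close> of the closure of \<open>P\<close>.\<close>

definition appr :: "(baire \<Rightarrow> baire \<Rightarrow> bool) \<Rightarrow> baire \<Rightarrow> nat list set" where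
  "appr P p = {s. \<exists>q z. P q z \<and> agree (length s) p q \<and> map z [0..<length s] = s}"

lemma is_tree_appr: "is_tree (appr P p)"
  unfolding is_tree_def
proof (intro allI impI, elim conjE)
  fix s t assume "t \<in> appr P p" and st: "prefix s t"
  then obtain q z where "P q z" "agree (length t) p q" and t: "map z [0..<length t] = t"
    unfolding appr_def by blast
  moreover have "map z [0..<length s] = s"
  proof -
    have "s = take (length s) (map z [0..<length t])" using st t by (auto simp: prefix_def)
    then show ?thesis using prefix_length_le[OF st] by (simp add: take_map_upt)
  qed
  ultimately show "s \<in> appr P p"
    unfolding appr_def using agree_mono prefix_length_le[OF st] by blast
qed

text \<open>The length of a node also bounds how closely names are compared, so membership depends
  on that many values of the name. This is the source of causality in
  \<open>ex_self_reference\<close> and of closedness in \<open>morph_appr_closed\<close>.\<close>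

lemma appr_agree:
  assumes "agree (length s) p q" "s \<in> appr P p"
  shows "s \<in> appr P q"
  using assms unfolding appr_def by (blast intro: agree_trans agree_sym)

lemma paths_appr: "y \<in> paths (appr P p) \<longleftrightarrow> (\<forall>n. \<exists>q z. P q z \<and> agree n p q \<and> agree n y z)"
proof -
  have "map z [0..<n] = map y [0..<n] \<longleftrightarrow> agree n y z" for z n by (auto simp: agree_def)
  then show ?thesis by (simp add: paths_def appr_def)
qed

lemma paths_apprI: "P p y \<Longrightarrow> y \<in> paths (appr P p)"
  unfolding paths_appr using agree_refl by blast

text \<open>The hypothesis says that each \<open>R d\<close> is closed in p and y jointly. The entry
  for a node sits at a position not below its length, and its value depends only on that many
  earlier values of p; so p can be defined recursively. All instances i are equal, since one answer
  suffices for the diagonal argument.\<close>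

lemma ex_self_reference:
  assumes "\<And>d p y. y \<in> paths (appr (R d) p) \<Longrightarrow> R d p y"
  shows "\<exists>p. \<forall>i d. \<exists>T. tree_rep (column (column p i) d) = Some T \<and> paths T = {y. R d p y}"
proof -
  define F :: "baire \<Rightarrow> baire" where
    "F p n = of_bool (list_decode (psnd (psnd n)) \<in> appr (R (pfst (psnd n))) p)" for p n
  have "F p n = F q n" if "agree n p q" for p q n
  proof -
    have "length (list_decode (psnd (psnd n))) \<le> psnd (psnd n)"
      using length_le_encode[of "list_decode (psnd (psnd n))"] by simp
    also have "\<dots> \<le> n"
      using le_prod_encode_2[of "psnd n" "pfst n"] le_prod_encode_2[of "psnd (psnd n)" "pfst (psnd n)"]
      by simp
    finally have "agree (length (list_decode (psnd (psnd n)))) p q"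
      using that agree_mono by blast
    then show ?thesis using appr_agree agree_sym unfolding F_def by (metis of_bool_eq_iff)
  qed
  from ex_causal_fixpoint[of F, OF this] obtain p where p: "F p = p" by blast
  have "tree_rep (column (column p i) d) = Some (appr (R d) p)" for i d
  proof (rule tree_rep_char)
    show "column (column p i) d (list_encode s) = of_bool (s \<in> appr (R d) p)" for s
      by (subst p[symmetric]) (simp add: column_def F_def)
  qed (rule is_tree_appr)
  moreover have "paths (appr (R d) p) = {y. R d p y}" for d
    using assms paths_apprI[of "R d" p] by auto
  ultimately show ?thesis by metis
qed

lemma agree_image:
  fixes n :: nat
  shows "agree (Suc (\<Sum>k<n. f k)) y z \<Longrightarrow> k < n \<Longrightarrow> y (f k) = z (f k)"
proof (erule agreeD)
  assume "k < n"
  then have "f k \<le> (\<Sum>k<n. f k)" by (intro member_le_sum) auto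
  then show "f k < Suc (\<Sum>k<n. f k)" by simp
qed

text \<open>Whether one node is mapped correctly depends on finitely many values of y and on as many
  values of p as the node is long. A pair close enough to (p, y) that satisfies the relation
  therefore decides it.\<close>

lemma morph_appr_closed:
  assumes g: "\<And>n. \<exists>N. \<forall>y z. agree N y z \<longrightarrow> agree n (g y) (g z)"
    and y: "y \<in> paths (appr (\<lambda>p y. morph (g y) (appr P p) (appr Q p)) p)"
  shows "morph (g y) (appr P p) (appr Q p)"
  unfolding morph_def
proof
  fix s assume s: "s \<in> appr P p"
  let ?f = "\<lambda>i. list_encode (take (Suc i) s)"
  obtain N where N: "\<And>y z. agree N y z \<Longrightarrow> agree (Suc (\<Sum>i<length s. ?f i)) (g y) (g z)"
    using g by blast
  obtain q z where q: "morph (g z) (appr P q) (appr Q q)" "agree (max N (length s)) p q"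
      "agree (max N (length s)) y z"
    using y unfolding paths_appr by blast
  then have a: "agree (length s) p q" "agree N y z"
    using agree_mono by (meson max.cobounded1 max.cobounded2)+
  have "lift (g y) s = lift (g z) s"
    unfolding lift_def
  proof (rule map_cong[OF refl])
    fix i assume "i \<in> set [0..<length s]"
    then show "g y (?f i) = g z (?f i)" using agree_image[OF N[OF a(2)], of i] by simp
  qed
  moreover have "lift (g z) s \<in> appr Q q"
    using q(1) appr_agree[OF a(1) s] by (auto simp: morph_def)
  ultimately show "lift (g y) s \<in> appr Q p"
    using appr_agree[OF agree_sym, of "lift (g y) s" p q Q] a(1) by simp
qed

lemma computable_modulus:
  assumes "computable F" "F p = Some h"
  shows "\<exists>N. \<forall>q h'. agree N p q \<and> F q = Some h' \<longrightarrow> h' c = h c"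
  using computable_continuous[OF assms, of c] unfolding eventually_sequentially by blast

lemma agree_join:
  assumes "agree n p q" "agree n y z"
  shows "agree n (join p y) (join q z)"
  unfolding agree_def
proof (intro allI impI)
  fix i assume "i < n"
  then have "i div 2 < n" by simp
  with assms show "join p y i = join q z i" by (simp add: agree_def join_def)
qed

lemma agree_map: "agree n y z \<Longrightarrow> m \<le> n \<Longrightarrow> map y [0..<m] = map z [0..<m]"
  by (simp add: agree_def)

text \<open>
  \<open>P d p\<close> collects the solutions of the \<open>UC_NN\<close>-instance for which the answer is \<open>d\<close>. The
  instance \<open>p\<close> refers to itself: \<open>d\<close> is a correct answer iff the tree of \<open>P d p\<close> maps to the tree of
  \<open>P (1 - d) p\<close>, which is false when the answer to the only solution is \<open>d\<close>.
\<close>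

lemma C_2_not_le_UC: "\<not> parallelization Sigma11_C_2 \<le>\<^sub>W UC_NN"
proof
  assume le: "parallelization Sigma11_C_2 \<le>\<^sub>W UC_NN"
  have named: "\<exists>q v. out_rep UC_NN q = Some v \<and> v \<in> val UC_NN u" if "val UC_NN u \<noteq> {}" for u
    using that by (auto simp: UC_NN_def baire_rep_def split: if_splits)
  obtain H K where HK: "computable H" "computable K"
    and red: "\<And>p x. in_rep (parallelization Sigma11_C_2) p = Some x \<Longrightarrow> val (parallelization Sigma11_C_2) x \<noteq> {} \<Longrightarrow>
      \<exists>h u. H p = Some h \<and> in_rep UC_NN h = Some u \<and> val UC_NN u \<noteq> {} \<and>
        (\<forall>q v. out_rep UC_NN q = Some v \<and> v \<in> val UC_NN u \<longrightarrow>
           (\<exists>k y. K (join p q) = Some k \<and> out_rep (parallelization Sigma11_C_2) k = Some y \<and>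
             y \<in> val (parallelization Sigma11_C_2) x))"
    by (rule weihrauch_leE[OF le]) (erule named, rule that)
  define P where "P d p y \<longleftrightarrow> (\<exists>h A k. H p = Some h \<and> closed_rep h = Some A \<and> y \<in> A \<and>
    K (join p y) = Some k \<and> k (prod_encode (0, 0)) = d)" for d :: nat and p y
  define R where "R d p y \<longleftrightarrow> morph y (appr (P d) p) (appr (P (1 - d)) p)" for d p y
  have "R d p y" if "y \<in> paths (appr (R d) p)" for d p y
    using morph_appr_closed[of "\<lambda>y. y" y "P d" "P (1 - d)" p] that unfolding R_def[abs_def] by blast
  from ex_self_reference[of R, OF this] obtain p T where
    T: "\<And>i d. tree_rep (column (column p i) d) = Some (T i d)" "\<And>i d. paths (T i d) = {y. R d p y}"
    by metis
  let ?S = "{b. \<exists>y. R (of_bool b) p y}"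
  have p: "in_rep (parallelization Sigma11_C_2) p = Some (\<lambda>_. ?S)"
    using sigma11_repI[of "column p _" of_bool, OF T(1)] by (simp add: seq_rep_iff T(2))
  have "?S \<noteq> {}"
  proof -
    have "False \<in> ?S \<or> True \<in> ?S"
      using morph_total[OF is_tree_appr is_tree_appr, of "P 0" p "P 1" p] by (simp add: R_def)
    then show ?thesis by blast
  qed
  then obtain b where "b \<in> ?S" by blast
  then have "(\<lambda>_. b) \<in> val (parallelization Sigma11_C_2) (\<lambda>_. ?S)" by simp
  then have "val (parallelization Sigma11_C_2) (\<lambda>_. ?S) \<noteq> {}" by blast
  from red[OF p this] obtain h A where h': "H p = Some h" "in_rep UC_NN h = Some A" and A: "val UC_NN A \<noteq> {}"
    and K': "\<And>q v. out_rep UC_NN q = Some v \<Longrightarrow> v \<in> val UC_NN A \<Longrightarrow> \<exists>k y. K (join p q) = Some k \<and>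
      out_rep (parallelization Sigma11_C_2) k = Some y \<and> y \<in> val (parallelization Sigma11_C_2) (\<lambda>_. ?S)"
    by blast
  have h: "H p = Some h" "closed_rep h = Some A" using h' by (simp_all add: UC_NN_def)
  have K: "\<exists>k y. K (join p q) = Some k \<and> seq_rep bool_rep k = Some y \<and> (\<forall>i. y i \<in> ?S)"
    if "q \<in> val UC_NN A" for q
    using K'[OF _ that, of q] by (simp add: UC_NN_def baire_rep_def)
  from A obtain x where x: "A = {x}" by (auto simp: UC_NN_def is_singleton_def split: if_splits)
  with K[of x] obtain k y where k: "K (join p x) = Some k" "seq_rep bool_rep k = Some y" "y 0 \<in> ?S"
    by (auto simp: UC_NN_def is_singleton_def)
  let ?d = "of_bool (y 0) :: nat"
  have k0: "k (prod_encode (0, 0)) = ?d"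
    using k(2) by (auto simp: seq_rep_iff bool_rep_iff column_def)
  with h k(1) x have "x \<in> paths (appr (P ?d) p)" by (intro paths_apprI) (auto simp: P_def)
  \<comment> \<open>That \<open>?d\<close> is a correct answer means that its tree, which has the
    path x, maps into the tree of the opposite answer; so the latter has a path too.\<close>
  moreover from k(3) obtain f where "morph f (appr (P ?d) p) (appr (P (1 - ?d)) p)" by (auto simp: R_def)
  ultimately obtain w where w: "w \<in> paths (appr (P (1 - ?d)) p)" using morph_paths by blast
  obtain V where V: "tree_rep h = Some V" "A = paths V" using h(2) by (auto simp: closed_rep_def)
  \<comment> \<open>Continuity of \<open>H\<close> at p: w is a limit of solutions of instances
    given by names close to p, hence solves the instance of p itself.\<close>
  have "h (list_encode (map w [0..<m])) = 1" for m
  proof -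
    obtain N where N: "\<And>q h'. agree N p q \<Longrightarrow> H q = Some h' \<Longrightarrow>
        h' (list_encode (map w [0..<m])) = h (list_encode (map w [0..<m]))"
      using computable_modulus[OF HK(1), OF h(1), of "list_encode (map w [0..<m])"] by blast
    obtain q z where q: "P (1 - ?d) q z" "agree (max N m) p q" "agree (max N m) w z"
      using w unfolding paths_appr by blast
    from q(1) obtain h' V' where h': "H q = Some h'" "tree_rep h' = Some V'" "z \<in> paths V'"
      by (auto simp: P_def closed_rep_def)
    from h'(2,3) have "h' (list_encode (map z [0..<m])) = 1" by (simp add: tree_rep_paths)
    moreover have "map w [0..<m] = map z [0..<m]" by (rule agree_map[OF q(3)]) simp
    ultimately have "h' (list_encode (map w [0..<m])) = 1" by (simp only:)
    then show ?thesis using N[of q h'] q(2) h'(1) agree_mono[of "max N m" p q N] by simp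
  qed
  then have "w \<in> A" using tree_rep_paths[OF V(1)] V(2) by simp
  with x have wx: "w = x" by simp
  \<comment> \<open>Continuity of \<open>K\<close> fixes the answer near (p, x), whereas x as a path
    of the second tree is a limit of points with the opposite answer.\<close>
  obtain N where N: "\<And>r k'. agree N (join p x) r \<Longrightarrow> K r = Some k' \<Longrightarrow> k' (prod_encode (0, 0)) = k (prod_encode (0, 0))"
    using computable_modulus[OF HK(2), OF k(1), of "prod_encode (0, 0)"] by blast
  obtain q z where q: "P (1 - ?d) q z" "agree N p q" "agree N x z"
    using w wx unfolding paths_appr by blast
  then obtain k' where "K (join q z) = Some k'" "k' (prod_encode (0, 0)) = 1 - ?d" by (auto simp: P_def)
  with N[OF agree_join[OF q(2,3)]] k0 show False by (cases "y 0") auto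
qed

lemma column_surj: "\<exists>y. \<forall>b. column y b = f b"
  by (rule exI[of _ "\<lambda>c. f (pfst c) (psnd c)"]) (simp add: column_def fun_eq_iff)

text \<open>Compactness by Koenig's lemma. In \<open>?W\<close> the number n is both a length and a
  bound on the value, so cutting a node weakens both conditions and a tree results. A path of it
  lies in \<open>paths W\<close> and has points of arbitrarily large value arbitrarily
  close.\<close>

lemma locally_constant_not_unbounded:
  fixes val :: "(nat \<Rightarrow> bool) \<Rightarrow> nat"
  assumes "is_tree W" "\<And>b. \<exists>x\<in>paths W. val x > b"
    and cont: "\<And>x. x \<in> paths W \<Longrightarrow> \<exists>n. \<forall>z\<in>paths W. map z [0..<n] = map x [0..<n] \<longrightarrow> val z = val x"
  shows False
proof -
  let ?W = "{map x [0..<n] | x n. x \<in> paths W \<and> val x > n}"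
  have "is_tree ?W"
    unfolding is_tree_def
  proof (intro allI impI, elim conjE)
    fix s t assume "t \<in> ?W" and st: "prefix s t"
    then obtain x n where t: "t = map x [0..<n]" "x \<in> paths W" "val x > n" by blast
    with prefix_length_le[OF st] have l: "length s \<le> n" by simp
    have "s = take (length s) t" using st by (auto simp: prefix_def)
    with l t(1) have "s = map x [0..<length s]" by (simp add: take_map_upt)
    with t l show "s \<in> ?W" by (intro CollectI exI[of _ x] exI[of _ "length s"]) simp
  qed
  moreover have "infinite ?W"
  proof
    assume "finite ?W"
    then have "finite (length ` ?W)" by blast
    moreover have "n \<in> length ` ?W" for n
    proof -
      obtain x where "x \<in> paths W" "val x > n" using assms(2) by blast
      then have "map x [0..<n] \<in> ?W" by blast
      then show ?thesis by (rule image_eqI[rotated]) simp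
    qed
    then have "UNIV \<subseteq> length ` ?W" by (rule subsetI)
    ultimately have "finite (UNIV :: nat set)" by (rule rev_finite_subset)
    then show False by simp
  qed
  ultimately obtain x where x: "x \<in> paths ?W" using koenig by blast
  have approx: "\<exists>z\<in>paths W. map z [0..<n] = map x [0..<n] \<and> val z > n" for n
  proof -
    from x have "map x [0..<n] \<in> ?W" by (simp add: paths_def)
    then obtain z m where z: "map x [0..<n] = map z [0..<m]" "z \<in> paths W" "val z > m" by blast
    from z(1) have "n = m" by (metis length_map length_upt diff_zero)
    with z show ?thesis by auto
  qed
  have "map x [0..<n] \<in> W" for n
  proof -
    obtain z where "z \<in> paths W" "map z [0..<n] = map x [0..<n]" using approx by blast
    moreover from this(1) have "map z [0..<n] \<in> W" by (simp add: paths_def)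
    ultimately show ?thesis by metis
  qed
  then have "x \<in> paths W" by (simp add: paths_def)
  from cont[OF this] obtain n where n: "\<And>z. z \<in> paths W \<Longrightarrow> map z [0..<n] = map x [0..<n] \<Longrightarrow> val z = val x"
    by blast
  obtain z where z: "z \<in> paths W" "map z [0..<max n (val x)] = map x [0..<max n (val x)]"
      "val z > max n (val x)"
    using approx by blast
  from z(2) have "map z [0..<n] = map x [0..<n]" by simp
  with n[OF z(1)] z(3) show False by simp
qed

text \<open>
  By compactness the answers to the paths of the tree \<open>W\<close> are bounded. \<open>P b p\<close> collects the paths with
  answer above \<open>b\<close>, together with witnesses that they are paths. The correct answers for the
  self-referential instance \<open>p\<close> are the numbers \<open>m + 1\<close> such that the tree of \<open>P m p\<close> has least rank.
\<close>

lemma C_N_not_le_WKL: "\<not> parallelization Sigma11_C_N \<le>\<^sub>W Sigma11_WKL"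
proof
  assume le: "parallelization Sigma11_C_N \<le>\<^sub>W Sigma11_WKL"
  have named: "\<exists>q v. out_rep Sigma11_WKL q = Some v \<and> v \<in> val Sigma11_WKL u" if ne: "val Sigma11_WKL u \<noteq> {}" for u
  proof -
    obtain v where v: "v \<in> val Sigma11_WKL u" using ne by blast
    have "out_rep Sigma11_WKL (\<lambda>n. of_bool (v n)) = Some v" by (simp add: Sigma11_WKL_def cantor_rep_iff)
    with v show ?thesis by blast
  qed
  obtain H K where HK: "computable H" "computable K"
    and red: "\<And>p x. in_rep (parallelization Sigma11_C_N) p = Some x \<Longrightarrow> val (parallelization Sigma11_C_N) x \<noteq> {} \<Longrightarrow>
      \<exists>h u. H p = Some h \<and> in_rep Sigma11_WKL h = Some u \<and> val Sigma11_WKL u \<noteq> {} \<and>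
        (\<forall>q v. out_rep Sigma11_WKL q = Some v \<and> v \<in> val Sigma11_WKL u \<longrightarrow>
           (\<exists>k y. K (join p q) = Some k \<and> out_rep (parallelization Sigma11_C_N) k = Some y \<and>
             y \<in> val (parallelization Sigma11_C_N) x))"
    by (rule weihrauch_leE[OF le]) (erule named, rule that)
  \<comment> \<open>Column 0 of y is a path of the tree named by \<open>H p\<close>, in bits; column
    n + 1 witnesses that its first n bits form a node.\<close>
  define P where "P b p y \<longleftrightarrow> (\<exists>h k. H p = Some h \<and> (\<forall>i. column y 0 i \<le> 1) \<and>
    (\<forall>n m. h (prod_encode (benc (column y 0) n, list_encode (map (column y (Suc n)) [0..<m]))) = 1) \<and>
    K (join p (column y 0)) = Some k \<and> k (prod_encode (0, 0)) > b)" for b :: nat and p y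
  \<comment> \<open>The shift by one ensures that a path answered by d lies in
    \<open>P (d - 1)\<close>, whose condition is a strict inequality. One y holds maps to all the
    trees, one per column.\<close>
  define R where "R d p y \<longleftrightarrow> d > 0 \<and> (\<forall>b. morph (column y b) (appr (P (d - 1)) p) (appr (P b) p))" for d p y
  have col: "\<exists>N. \<forall>y z. agree N y z \<longrightarrow> agree n (column y b) (column z b)" for b n
    using agree_image[where n = n and f = "\<lambda>i. prod_encode (b, i)"] unfolding agree_def[of n] column_def by blast
  have "R d p y" if y: "y \<in> paths (appr (R d) p)" for d p y
  proof -
    have "y \<in> paths (appr (\<lambda>p y. morph (column y b) (appr (P (d - 1)) p) (appr (P b) p)) p)" for b
      using y unfolding paths_appr R_def by blast
    from morph_appr_closed[OF col this] have "morph (column y b) (appr (P (d - 1)) p) (appr (P b) p)" for b .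
    moreover have "d > 0" using y unfolding paths_appr R_def by blast
    ultimately show ?thesis by (simp add: R_def)
  qed
  from ex_self_reference[of R, OF this] obtain p T where
    T: "\<And>i d. tree_rep (column (column p i) d) = Some (T i d)" "\<And>i d. paths (T i d) = {y. R d p y}"
    by metis
  define least where "least m \<longleftrightarrow> (\<forall>b. \<exists>y. morph y (appr (P m) p) (appr (P b) p))" for m
  let ?S = "{d. \<exists>y. R d p y}"
  have S: "d \<in> ?S \<longleftrightarrow> d > 0 \<and> least (d - 1)" for d
  proof
    assume d: "d > 0 \<and> least (d - 1)"
    then obtain f where f: "\<And>b. morph (f b) (appr (P (d - 1)) p) (appr (P b) p)" unfolding least_def by metis
    obtain y where "\<And>b. column y b = f b" using column_surj by blast
    with d f have "R d p y" by (simp add: R_def)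
    then show "d \<in> ?S" by blast
  qed (auto simp: R_def least_def)
  have "\<exists>m. least m"
  proof (rule ccontr)
    assume "\<nexists>m. least m"
    then obtain f where f: "\<And>m y. \<not> morph y (appr (P m) p) (appr (P (f m)) p)" unfolding least_def by metis
    \<comment> \<open>The descending sequence starts with the index \<open>f 0\<close>: a path in
      this tree gives a map from the tree of index 0 into it, which the choice of f
      excludes.\<close>
    have "paths (appr (P ((f ^^ Suc 0) 0)) p) \<noteq> {}"
      by (rule morph_wf[of "\<lambda>i. appr (P ((f ^^ Suc i) 0)) p"]) (simp_all add: is_tree_appr f)
    with morph_to_path f[of _ 0] show False by auto
  qed
  then obtain m0 where "least m0" ..
  then have "Suc m0 \<in> ?S" unfolding S by simp
  then have "(\<lambda>_. Suc m0) \<in> val (parallelization Sigma11_C_N) (\<lambda>_. ?S)" by simp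
  then have ne: "val (parallelization Sigma11_C_N) (\<lambda>_. ?S) \<noteq> {}" by blast
  have "in_rep (parallelization Sigma11_C_N) p = Some (\<lambda>_. ?S)"
    using sigma11_repI[of "column p _" id] T by (simp add: seq_rep_iff)
  from red[OF this ne] obtain h W where h': "H p = Some h" "in_rep Sigma11_WKL h = Some W"
    and W: "val Sigma11_WKL W \<noteq> {}"
    and K': "\<And>q v. out_rep Sigma11_WKL q = Some v \<Longrightarrow> v \<in> val Sigma11_WKL W \<Longrightarrow> \<exists>k y. K (join p q) = Some k \<and>
      out_rep (parallelization Sigma11_C_N) k = Some y \<and> y \<in> val (parallelization Sigma11_C_N) (\<lambda>_. ?S)"
    by blast
  have h: "H p = Some h" "sigma11_rep bin_encode h = Some W"
    using h' by (simp_all add: Sigma11_WKL_def)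
  have K: "\<exists>k y. K (join p (\<lambda>n. of_bool (x n))) = Some k \<and> seq_rep nat_rep k = Some y \<and> (\<forall>i. y i \<in> ?S)"
    if "x \<in> val Sigma11_WKL W" for x
    using K'[OF _ that, of "\<lambda>n. of_bool (x n)"] by (simp add: Sigma11_WKL_def cantor_rep_iff)
  have tree: "is_tree W" and inf: "infinite W" and val: "val Sigma11_WKL W = paths W"
    using W by (auto simp: Sigma11_WKL_def split: if_splits)
  define a where "a x = the (K (join p (\<lambda>n. of_bool (x n)))) (prod_encode (0, 0))" for x :: "nat \<Rightarrow> bool"
  have a: "a x \<in> ?S" "\<exists>k. K (join p (\<lambda>n. of_bool (x n))) = Some k \<and> k (prod_encode (0, 0)) = a x"
    if "x \<in> paths W" for x
  proof -
    from K[of x] that obtain k y where k: "K (join p (\<lambda>n. of_bool (x n))) = Some k" "seq_rep nat_rep k = Some y"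
      "y 0 \<in> ?S" by (auto simp: val)
    from k(1) show "\<exists>k. K (join p (\<lambda>n. of_bool (x n))) = Some k \<and> k (prod_encode (0, 0)) = a x"
      by (simp add: a_def)
    have "a x = y 0" using k(1,2) by (auto simp: a_def seq_rep_iff nat_rep_def column_def)
    with k(3) show "a x \<in> ?S" by simp
  qed
  obtain V where V: "\<And>\<sigma>. tree_rep (column h (bin_encode \<sigma>)) = Some (V \<sigma>)" "W = {\<sigma>. paths (V \<sigma>) \<noteq> {}}"
    using h(2) by (rule sigma11_repE) (rule that)
  have paths_W: "x \<in> paths W \<longleftrightarrow> (\<forall>n. paths (V (map x [0..<n])) \<noteq> {})" for x
    unfolding paths_def[of W] by (simp add: V(2))
  \<comment> \<open>The closure adds nothing here: continuity of \<open>H\<close> at p makes column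
    0 of a limit a path of W, and continuity of \<open>K\<close> transfers the bound on the
    answer.\<close>
  have above: "\<exists>x\<in>paths W. a x > b" if ne: "paths (appr (P b) p) \<noteq> {}" for b
  proof -
    obtain w where w: "w \<in> paths (appr (P b) p)" using ne by blast
    define x where "x i \<longleftrightarrow> column w 0 i = 1" for i
    have near: "\<exists>q z. P b q z \<and> agree N p q \<and> (\<forall>c<M. agree N (column w c) (column z c))" for N M
    proof -
      have "\<exists>L. \<forall>z. agree L w z \<longrightarrow> (\<forall>c<M. agree N (column w c) (column z c))"
      proof -
        obtain L where L: "\<And>c y z. agree (L c) y z \<Longrightarrow> agree N (column y c) (column z c)"
          using col[of N] by metis
        have "agree N (column w c) (column z c)" if "agree (\<Sum>c<M. L c) w z" "c < M" for z c
        proof (rule L, rule agree_mono[OF that(1)])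
          show "L c \<le> (\<Sum>c<M. L c)" using that(2) by (intro member_le_sum) auto
        qed
        then show ?thesis by blast
      qed
      then obtain L where L: "\<And>z. agree L w z \<Longrightarrow> \<forall>c<M. agree N (column w c) (column z c)" by blast
      obtain q z where "P b q z" "agree (max L N) p q" "agree (max L N) w z"
        using w unfolding paths_appr by blast
      moreover from this have "agree N p q" "agree L w z"
        using agree_mono by (meson max.cobounded1 max.cobounded2)+
      ultimately show ?thesis using L by blast
    qed
    have x: "column w 0 i = of_bool (x i)" for i
    proof -
      obtain q z where "P b q z" "agree (Suc i) (column w 0) (column z 0)"
        using near[of "Suc i" 1] by auto
      then have "column z 0 i \<le> 1" "column w 0 i = column z 0 i" by (auto simp: P_def agree_def)
      then show ?thesis by (auto simp: x_def)
    qed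
    have "column h (bin_encode (map x [0..<n])) (list_encode (map (column w (Suc n)) [0..<m])) = 1" for n m
    proof -
      let ?c = "prod_encode (bin_encode (map x [0..<n]), list_encode (map (column w (Suc n)) [0..<m]))"
      obtain N where N: "\<And>q h'. agree N p q \<Longrightarrow> H q = Some h' \<Longrightarrow> h' ?c = h ?c"
        using computable_modulus[OF HK(1), OF h(1), of ?c] by blast
      let ?N = "max N (max n m)"
      obtain q z where q: "P b q z" "agree ?N p q" "\<forall>c<n + 2. agree ?N (column w c) (column z c)"
        using near by blast
      then obtain h' where h': "H q = Some h'"
        "h' (prod_encode (benc (column z 0) n, list_encode (map (column z (Suc n)) [0..<m]))) = 1"
        by (auto simp: P_def)
      have "benc (column w 0) j = benc (column z 0) j" if "j \<le> n" for j
        using that q(3)[rule_format, of 0] by (induction j) (simp_all add: benc_def agree_def)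
      moreover have "benc (column w 0) n = bin_encode (map x [0..<n])"
        unfolding ext[of "column w 0", OF x] by (rule benc_bin_encode)
      moreover have "map (column w (Suc n)) [0..<m] = map (column z (Suc n)) [0..<m]"
        by (rule agree_map[OF q(3)[rule_format]]) simp_all
      ultimately have "h' ?c = 1" using h'(2) by (metis order_refl)
      with N[of q h'] h'(1) agree_mono[OF q(2), of N] show ?thesis by (simp add: column_def)
    qed
    then have "column w (Suc n) \<in> paths (V (map x [0..<n]))" for n
      using tree_rep_paths[OF V(1)] by blast
    then have xW: "x \<in> paths W" unfolding paths_W by blast
    obtain k where k: "K (join p (\<lambda>n. of_bool (x n))) = Some k" "k (prod_encode (0, 0)) = a x"
      using a(2)[OF xW] by blast
    obtain N where "\<forall>r k'. agree N (join p (\<lambda>n. of_bool (x n))) r \<and> K r = Some k' \<longrightarrow>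
        k' (prod_encode (0, 0)) = k (prod_encode (0, 0))"
      using computable_modulus[OF HK(2), OF k(1)] by (rule exE)
    note N = this[rule_format, OF conjI]
    obtain q z where q: "P b q z" "agree N p q" "agree N (column w 0) (column z 0)"
      using near[of N 1] by auto
    then obtain k' where k': "K (join q (column z 0)) = Some k'" "k' (prod_encode (0, 0)) > b"
      by (auto simp: P_def)
    from q(3) have "agree N (\<lambda>n. of_bool (x n)) (column z 0)" by (simp add: agree_def x)
    with N[OF agree_join[OF q(2)] k'(1)] k' k have "a x > b" by simp
    with xW show ?thesis by blast
  qed
  have below: "paths (appr (P b) p) \<noteq> {}" if x: "x \<in> paths W" and b: "a x > b" for x b
  proof -
    from x have "\<forall>n. \<exists>z. z \<in> paths (V (map x [0..<n]))" unfolding paths_W by blast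
    then obtain z where z: "\<And>n. z n \<in> paths (V (map x [0..<n]))" by metis
    obtain y where y: "\<And>c. column y c = (case c of 0 \<Rightarrow> (\<lambda>i. of_bool (x i)) | Suc n \<Rightarrow> z n)"
      using column_surj[of "\<lambda>c. case c of 0 \<Rightarrow> (\<lambda>i. of_bool (x i)) | Suc n \<Rightarrow> z n"] by blast
    have "h (prod_encode (bin_encode (map x [0..<n]), list_encode (map (z n) [0..<m]))) = 1" for n m
      using z[of n] tree_rep_paths[OF V(1)] by (simp add: column_def)
    moreover from a(2)[OF x] obtain k where "K (join p (\<lambda>n. of_bool (x n))) = Some k"
      "k (prod_encode (0, 0)) = a x" by blast
    ultimately have "P b p y"
      using b h(1) unfolding P_def y nat.case benc_bin_encode
      by (intro exI[of _ h] exI[of _ k] conjI allI) simp_all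
    then have "y \<in> paths (appr (P b) p)" by (rule paths_apprI[of "P b"])
    then show ?thesis by blast
  qed
  \<comment> \<open>The answer is locally constant on the paths of W by continuity of
    \<open>K\<close>, so compactness applies.\<close>
  have "\<exists>b. \<forall>x\<in>paths W. a x \<le> b"
  proof (rule ccontr)
    assume "\<nexists>b. \<forall>x\<in>paths W. a x \<le> b"
    then have "\<exists>x\<in>paths W. a x > b" for b by (meson not_le)
    then show False
    proof (rule locally_constant_not_unbounded[OF tree])
      fix x assume x: "x \<in> paths W"
      obtain k where k: "K (join p (\<lambda>n. of_bool (x n))) = Some k" "k (prod_encode (0, 0)) = a x"
        using a(2)[OF x] by blast
      obtain N where "\<forall>r k'. agree N (join p (\<lambda>n. of_bool (x n))) r \<and> K r = Some k' \<longrightarrow>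
          k' (prod_encode (0, 0)) = k (prod_encode (0, 0))"
        using computable_modulus[OF HK(2), OF k(1)] by (rule exE)
      note N = this[rule_format, OF conjI]
      have "a z = a x" if z: "z \<in> paths W" "map z [0..<N] = map x [0..<N]" for z
      proof -
        obtain k' where k': "K (join p (\<lambda>n. of_bool (z n))) = Some k'" "k' (prod_encode (0, 0)) = a z"
          using a(2)[OF z(1)] by blast
        have "agree N (\<lambda>n. of_bool (x n)) (\<lambda>n. of_bool (z n))" using z(2) by (simp add: agree_def)
        from N[OF agree_join[OF agree_refl this] k'(1)] k' k show ?thesis by simp
      qed
      then show "\<exists>n. \<forall>z\<in>paths W. map z [0..<n] = map x [0..<n] \<longrightarrow> a z = a x" by blast
    qed
  qed
  then obtain b where "\<And>x. x \<in> paths W \<Longrightarrow> a x \<le> b" by blast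
  \<comment> \<open>A bound on all answers leaves \<open>P b\<close> without paths, and the tree of
    least rank maps into it. But the actual answer exceeds \<open>?m\<close>, so a path of W with
    its witnesses is a path of that very tree.\<close>
  then have empty: "paths (appr (P b) p) = {}" using above[of b] by (meson not_le)
  let ?m = "LEAST m. least m"
  have "least ?m" using \<open>least m0\<close> by (rule LeastI)
  then obtain y where "morph y (appr (P ?m) p) (appr (P b) p)" unfolding least_def by blast
  with empty have m: "paths (appr (P ?m) p) = {}" using morph_paths by blast
  obtain x where x: "x \<in> paths W" using koenig[OF tree inf] by blast
  from a(1)[OF x] have "a x > 0" "least (a x - 1)" unfolding S by simp_all
  then have "a x > ?m" using Least_le[of least "a x - 1"] by simp
  from below[OF x this] m show False by simp
qed

theorem theorem4p3:
  shows "UC_NN <\<^sub>W parallelization Sigma11_C_2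
    \<and> parallelization Sigma11_C_2 \<equiv>\<^sub>W Pi11_Sep
    \<and> Pi11_Sep \<equiv>\<^sub>W Sigma11_WKL
    \<and> Sigma11_WKL <\<^sub>W parallelization Sigma11_C_N
    \<and> parallelization Sigma11_C_N \<le>\<^sub>W C_NN"
  unfolding weihrauch_less_def weihrauch_equiv_def
  using UC_le_C_2 C_2_not_le_UC C_2_le_Sep weihrauch_le_trans[OF Sep_le_WKL WKL_le_C_2] Sep_le_WKL
    weihrauch_le_trans[OF WKL_le_C_2 C_2_le_Sep] weihrauch_le_trans[OF WKL_le_C_2 C_2_le_C_N]
    C_N_not_le_WKL C_N_le_C_NN
  by blast

end
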